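(* Let $\mathbb{K}$ be a field and $V$ a $\mathbb{K}$-vector space. The unital dendriform algebra $\widetilde D(V)=\mathbb{K}\cdot1\oplus D(V)$, where $D(V)$ is the free dendriform algebra on $V$, equipped with the Loday–Ronco coproduct $\Delta$, is a dendriform bialgebra.
   Context: Work over a field $\mathbb{K}$. **Dendriform algebras.** A dendriform algebra is a vector space $W$ with bilinear products $\prec,\succ$ such that $(x\prec y)\prec z=x\prec(y\prec z)+x\prec(y\succ z)$, $(x\succ y)\prec z=x\succ(y\prec z)$ (written $x\succ y\prec z$), $x\succ(y\succ z)=(x\succ y)\succ z+(x\prec y)\succ z$. The product $x*y:=x\prec y+x\succ y$ is associative. **Unital dendriform algebras.** A unital dendriform algebra is a vector space $W=\mathbb{K}\cdot1\oplus V$ with maps $\prec,\succ:V\otimes W+W\otimes V\to V$ such that $(V,\prec,\succ)$ is a dendriform algebra and $1\prec x=x\succ1=0$, $x\prec1=1\succ x=x$ for $x\in V$; put $1*1=1$. For a dendriform algebra $D$, $\widetilde D:=\mathbb{K}\cdot1\oplus D$ is naturally a unital dendriform algebra. **Dendriform bialgebras.** A dendriform bialgebra is a unital dendriform algebra $W=\mathbb{K}\cdot1\oplus V$ with a coassociative coproduct $\Delta:W\to W\otimes W$ such that $\Delta(1)=1\otimes1$, the projection onto $\mathbb{K}\cdot 1$ along $V$ is a counit, and for all $x,y\in V$ (Sweedler notation) $$\Delta(x\succ y)=(x_{(1)}*y_{(1)})\otimes(x_{(2)}\succ y_{(2)})-(x*y)\otimes(1\succ1)+(x\succ y)\otimes1,$$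 $$\Delta(x\prec y)=(x_{(1)}*y_{(1)})\otimes(x_{(2)}\prec y_{(2)})-(x*y)\otimes(1\prec1)+(x\prec y)\otimes1,$$ where subtracting the undefined terms $1\succ1$, $1\prec1$ means that in the Sweedler sum the single term with $x_{(2)}=y_{(2)}=1$ is omitted. **The coproduct.** For $x,y\in\widetilde D(V)$ and $v\in V$ put $x\stackrel{v}{\vee}y:=x\succ v\prec y$; the map $\widetilde D(V)\otimes V\otimes\widetilde D(V)\to D(V)$, $x\otimes v\otimes y\mapsto x\stackrel{v}{\vee}y$, is a linear isomorphism. The coproduct $\Delta$ on $\widetilde D(V)$ (Loday–Ronco) is the linear map determined recursively by $\Delta(1)=1\otimes1$ and $$\Delta(x\stackrel{v}{\vee}y)=(x\stackrel{v}{\vee}y)\otimes1+(x_{(1)}*y_{(1)})\otimes(x_{(2)}\stackrel{v}{\vee}y_{(2)}).$$ It is known (Loday–Ronco) that $\Delta$ is coassociative and is a morphism of associative algebras for $*$. *)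

theory Defs
  imports "HOL-Algebra.Module"
begin

section \<open>Linear and bilinear maps\<close>

definition linear_map ::
  "('k, 'm) ring_scheme \<Rightarrow> ('k, 'a, 'p) module_scheme \<Rightarrow> ('k, 'b, 'q) module_scheme \<Rightarrow> ('a \<Rightarrow> 'b) \<Rightarrow> bool"
  where "linear_map K M N f \<longleftrightarrow>
    f \<in> carrier M \<rightarrow> carrier N \<and>
    (\<forall>x\<in>carrier M. \<forall>y\<in>carrier M. f (x \<oplus>\<^bsub>M\<^esub> y) = f x \<oplus>\<^bsub>N\<^esub> f y) \<and>
    (\<forall>a\<in>carrier K. \<forall>x\<in>carrier M. f (a \<odot>\<^bsub>M\<^esub> x) = a \<odot>\<^bsub>N\<^esub> f x)"

definition bilinear_map ::
  "('k, 'm) ring_scheme \<Rightarrow> ('k, 'a, 'p) module_scheme \<Rightarrow> ('k, 'b, 'q) module_scheme \<Rightarrow>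
   ('k, 'c, 'r) module_scheme \<Rightarrow> ('a \<Rightarrow> 'b \<Rightarrow> 'c) \<Rightarrow> bool"
  where "bilinear_map K L M N f \<longleftrightarrow>
    (\<forall>x\<in>carrier L. linear_map K M N (f x)) \<and>
    (\<forall>y\<in>carrier M. linear_map K L N (\<lambda>x. f x y))"


section \<open>Tensor products\<close>

text \<open>The tensor product of two vector spaces is presented by generators and relations: its
  elements are the classes of formal linear combinations of pairs under the least congruence
  containing the vector space axioms and the bilinearity of \<open>(a, b) \<mapsto> TPure a b\<close>.\<close>

datatype ('k, 'a, 'b) tterm =
    TZero
  | TPure 'a 'b
  | TAdd "('k, 'a, 'b) tterm" "('k, 'a, 'b) tterm"
  | TSmult 'k "('k, 'a, 'b) tterm"

inductive_set tterms ::
  "('k, 'm) ring_scheme \<Rightarrow> ('k, 'a, 'p) module_scheme \<Rightarrow> ('k, 'b, 'q) module_scheme \<Rightarrow>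
   ('k, 'a, 'b) tterm set"
  for K A B where
  zero: "TZero \<in> tterms K A B"
| pure: "\<lbrakk>a \<in> carrier A; b \<in> carrier B\<rbrakk> \<Longrightarrow> TPure a b \<in> tterms K A B"
| add: "\<lbrakk>s \<in> tterms K A B; t \<in> tterms K A B\<rbrakk> \<Longrightarrow> TAdd s t \<in> tterms K A B"
| smult: "\<lbrakk>c \<in> carrier K; s \<in> tterms K A B\<rbrakk> \<Longrightarrow> TSmult c s \<in> tterms K A B"

inductive tensor_eq ::
  "('k, 'm) ring_scheme \<Rightarrow> ('k, 'a, 'p) module_scheme \<Rightarrow> ('k, 'b, 'q) module_scheme \<Rightarrow>
   ('k, 'a, 'b) tterm \<Rightarrow> ('k, 'a, 'b) tterm \<Rightarrow> bool"
  for K A B where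
  refl: "s \<in> tterms K A B \<Longrightarrow> tensor_eq K A B s s"
| sym: "tensor_eq K A B s t \<Longrightarrow> tensor_eq K A B t s"
| trans: "\<lbrakk>tensor_eq K A B s t; tensor_eq K A B t u\<rbrakk> \<Longrightarrow> tensor_eq K A B s u"
| add_cong: "\<lbrakk>tensor_eq K A B s s'; tensor_eq K A B t t'\<rbrakk> \<Longrightarrow>
    tensor_eq K A B (TAdd s t) (TAdd s' t')"
| smult_cong: "\<lbrakk>c \<in> carrier K; tensor_eq K A B s s'\<rbrakk> \<Longrightarrow>
    tensor_eq K A B (TSmult c s) (TSmult c s')"
| add_assoc: "\<lbrakk>s \<in> tterms K A B; t \<in> tterms K A B; u \<in> tterms K A B\<rbrakk> \<Longrightarrow>
    tensor_eq K A B (TAdd (TAdd s t) u) (TAdd s (TAdd t u))"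
| add_comm: "\<lbrakk>s \<in> tterms K A B; t \<in> tterms K A B\<rbrakk> \<Longrightarrow>
    tensor_eq K A B (TAdd s t) (TAdd t s)"
| zero_add: "s \<in> tterms K A B \<Longrightarrow> tensor_eq K A B (TAdd TZero s) s"
| smult_zero: "s \<in> tterms K A B \<Longrightarrow> tensor_eq K A B (TSmult \<zero>\<^bsub>K\<^esub> s) TZero"
| smult_one: "s \<in> tterms K A B \<Longrightarrow> tensor_eq K A B (TSmult \<one>\<^bsub>K\<^esub> s) s"
| smult_smult: "\<lbrakk>c \<in> carrier K; d \<in> carrier K; s \<in> tterms K A B\<rbrakk> \<Longrightarrow>
    tensor_eq K A B (TSmult (c \<otimes>\<^bsub>K\<^esub> d) s) (TSmult c (TSmult d s))"
| smult_l: "\<lbrakk>c \<in> carrier K; d \<in> carrier K; s \<in> tterms K A B\<rbrakk> \<Longrightarrow>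
    tensor_eq K A B (TSmult (c \<oplus>\<^bsub>K\<^esub> d) s) (TAdd (TSmult c s) (TSmult d s))"
| smult_r: "\<lbrakk>c \<in> carrier K; s \<in> tterms K A B; t \<in> tterms K A B\<rbrakk> \<Longrightarrow>
    tensor_eq K A B (TSmult c (TAdd s t)) (TAdd (TSmult c s) (TSmult c t))"
| pure_add_l: "\<lbrakk>a \<in> carrier A; a' \<in> carrier A; b \<in> carrier B\<rbrakk> \<Longrightarrow>
    tensor_eq K A B (TPure (a \<oplus>\<^bsub>A\<^esub> a') b) (TAdd (TPure a b) (TPure a' b))"
| pure_add_r: "\<lbrakk>a \<in> carrier A; b \<in> carrier B; b' \<in> carrier B\<rbrakk> \<Longrightarrow>
    tensor_eq K A B (TPure a (b \<oplus>\<^bsub>B\<^esub> b')) (TAdd (TPure a b) (TPure a b'))"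
| pure_smult_l: "\<lbrakk>c \<in> carrier K; a \<in> carrier A; b \<in> carrier B\<rbrakk> \<Longrightarrow>
    tensor_eq K A B (TPure (c \<odot>\<^bsub>A\<^esub> a) b) (TSmult c (TPure a b))"
| pure_smult_r: "\<lbrakk>c \<in> carrier K; a \<in> carrier A; b \<in> carrier B\<rbrakk> \<Longrightarrow>
    tensor_eq K A B (TPure a (c \<odot>\<^bsub>B\<^esub> b)) (TSmult c (TPure a b))"

definition tensor_class ::
  "('k, 'm) ring_scheme \<Rightarrow> ('k, 'a, 'p) module_scheme \<Rightarrow> ('k, 'b, 'q) module_scheme \<Rightarrow>
   ('k, 'a, 'b) tterm \<Rightarrow> ('k, 'a, 'b) tterm set"
  where "tensor_class K A B t = {s. tensor_eq K A B t s}"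

definition class_rep :: "'t set \<Rightarrow> 't"
  where "class_rep X = (SOME t. t \<in> X)"

text \<open>The fields \<open>mult\<close> and \<open>one\<close>, which every \<open>module\<close> record carries, have no meaning here.\<close>

definition tensor ::
  "('k, 'm) ring_scheme \<Rightarrow> ('k, 'a, 'p) module_scheme \<Rightarrow> ('k, 'b, 'q) module_scheme \<Rightarrow>
   ('k, ('k, 'a, 'b) tterm set) module"
  where "tensor K A B =
    \<lparr>carrier = tensor_class K A B ` tterms K A B,
     mult = undefined, one = undefined,
     zero = tensor_class K A B TZero,
     add = (\<lambda>X Y. tensor_class K A B (TAdd (class_rep X) (class_rep Y))),
     smult = (\<lambda>c X. tensor_class K A B (TSmult c (class_rep X)))\<rparr>"

definition pure_tensor ::
  "('k, 'm) ring_scheme \<Rightarrow> ('k, 'a, 'p) module_scheme \<Rightarrow> ('k, 'b, 'q) module_scheme \<Rightarrow>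
   'a \<Rightarrow> 'b \<Rightarrow> ('k, 'a, 'b) tterm set"
  where "pure_tensor K A B a b = tensor_class K A B (TPure a b)"

primrec tterm_eval ::
  "('k, 'c, 'r) module_scheme \<Rightarrow> ('a \<Rightarrow> 'b \<Rightarrow> 'c) \<Rightarrow> ('k, 'a, 'b) tterm \<Rightarrow> 'c" where
  "tterm_eval N f TZero = \<zero>\<^bsub>N\<^esub>"
| "tterm_eval N f (TPure a b) = f a b"
| "tterm_eval N f (TAdd s t) = tterm_eval N f s \<oplus>\<^bsub>N\<^esub> tterm_eval N f t"
| "tterm_eval N f (TSmult c s) = c \<odot>\<^bsub>N\<^esub> tterm_eval N f s"

text \<open>For bilinear \<open>f\<close>, this is the linear map with \<open>a \<otimes> b \<mapsto> f a b\<close>; see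
  \<open>tensor_universal\<close> below. Sums in Sweedler notation are expressed through it:
  \<open>tensor_lift N f (\<Delta> x)\<close> is the sum of all \<open>f x\<^sub>(\<^sub>1\<^sub>) x\<^sub>(\<^sub>2\<^sub>)\<close>.\<close>

definition tensor_lift ::
  "('k, 'c, 'r) module_scheme \<Rightarrow> ('a \<Rightarrow> 'b \<Rightarrow> 'c) \<Rightarrow> ('k, 'a, 'b) tterm set \<Rightarrow> 'c"
  where "tensor_lift N f X = tterm_eval N f (class_rep X)"

lemmas tensor_eq_axioms = tensor_eq.add_assoc tensor_eq.add_comm tensor_eq.zero_add
  tensor_eq.smult_one tensor_eq.smult_smult tensor_eq.smult_l tensor_eq.smult_r
  tensor_eq.pure_add_l tensor_eq.pure_add_r tensor_eq.pure_smult_l tensor_eq.pure_smult_r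

lemma tensor_eq_terms:
  assumes "module K A" and "module K B" and "tensor_eq K A B s t"
  shows "s \<in> tterms K A B" and "t \<in> tterms K A B"
proof -
  interpret A: module K A by fact
  interpret B: module K B by fact
  from assms(3) have "s \<in> tterms K A B \<and> t \<in> tterms K A B"
    by induction (auto intro!: tterms.intros)
  then show "s \<in> tterms K A B" and "t \<in> tterms K A B" by auto
qed

lemma tensor_class_eqI: "tensor_eq K A B s t \<Longrightarrow> tensor_class K A B s = tensor_class K A B t"
  unfolding tensor_class_def
  by (auto dest: tensor_eq.trans[of K A B s t]
      tensor_eq.trans[OF tensor_eq.sym, of K A B s t])

lemma class_rep_tensor_class:
  assumes "s \<in> tterms K A B"
  shows "tensor_eq K A B s (class_rep (tensor_class K A B s))"
proof -
  have "s \<in> tensor_class K A B s"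
    using assms by (simp add: tensor_class_def tensor_eq.refl)
  then have "class_rep (tensor_class K A B s) \<in> tensor_class K A B s"
    unfolding class_rep_def by (rule someI)
  then show ?thesis by (simp add: tensor_class_def)
qed

lemma tensor_simps:
  "carrier (tensor K A B) = tensor_class K A B ` tterms K A B"
  "\<zero>\<^bsub>tensor K A B\<^esub> = tensor_class K A B TZero"
  "\<lbrakk>s \<in> tterms K A B; t \<in> tterms K A B\<rbrakk> \<Longrightarrow>
    tensor_class K A B s \<oplus>\<^bsub>tensor K A B\<^esub> tensor_class K A B t = tensor_class K A B (TAdd s t)"
  "\<lbrakk>c \<in> carrier K; s \<in> tterms K A B\<rbrakk> \<Longrightarrow>
    c \<odot>\<^bsub>tensor K A B\<^esub> tensor_class K A B s = tensor_class K A B (TSmult c s)"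
  by (auto simp: tensor_def intro!: tensor_class_eqI[OF tensor_eq.sym]
      tensor_eq.add_cong tensor_eq.smult_cong class_rep_tensor_class)

lemma module_tensor:
  assumes "module K A" and "module K B"
  shows "module K (tensor K A B)"
proof -
  interpret A: module K A by fact
  show ?thesis
  proof (rule moduleI)
    show "cring K" by (rule A.is_cring)
    show "abelian_group (tensor K A B)"
    proof (rule abelian_groupI)
      fix x assume "x \<in> carrier (tensor K A B)"
      then obtain s where s: "s \<in> tterms K A B" "x = tensor_class K A B s"
        by (auto simp: tensor_simps)
      have m1: "\<ominus>\<^bsub>K\<^esub> \<one>\<^bsub>K\<^esub> \<in> carrier K" by simp
      have "tensor_eq K A B (TAdd (TSmult (\<ominus>\<^bsub>K\<^esub> \<one>\<^bsub>K\<^esub>) s) s)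
          (TAdd (TSmult (\<ominus>\<^bsub>K\<^esub> \<one>\<^bsub>K\<^esub>) s) (TSmult \<one>\<^bsub>K\<^esub> s))"
        using s m1 by (auto intro!: tensor_eq.add_cong tensor_eq.refl tterms.intros
            tensor_eq.sym[OF tensor_eq.smult_one])
      moreover have "tensor_eq K A B (TAdd (TSmult (\<ominus>\<^bsub>K\<^esub> \<one>\<^bsub>K\<^esub>) s) (TSmult \<one>\<^bsub>K\<^esub> s)) TZero"
        using tensor_eq.smult_l[of "\<ominus>\<^bsub>K\<^esub> \<one>\<^bsub>K\<^esub>" K "\<one>\<^bsub>K\<^esub>" s A B] s m1
        by (simp add: A.R.l_neg)
          (rule tensor_eq.trans[OF tensor_eq.sym tensor_eq.smult_zero])
      ultimately have "tensor_eq K A B (TAdd (TSmult (\<ominus>\<^bsub>K\<^esub> \<one>\<^bsub>K\<^esub>) s) s) TZero"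
        by (rule tensor_eq.trans)
      then have "tensor_class K A B (TSmult (\<ominus>\<^bsub>K\<^esub> \<one>\<^bsub>K\<^esub>) s) \<oplus>\<^bsub>tensor K A B\<^esub> x = \<zero>\<^bsub>tensor K A B\<^esub>"
        using s m1 by (auto simp: tensor_simps tterms.intros intro!: tensor_class_eqI)
      then show "\<exists>y\<in>carrier (tensor K A B). y \<oplus>\<^bsub>tensor K A B\<^esub> x = \<zero>\<^bsub>tensor K A B\<^esub>"
        by (rule bexI) (use s m1 in \<open>simp add: tensor_simps tterms.intros\<close>)
    qed (auto simp: tensor_simps tterms.intros del: equalityI intro!: tensor_class_eqI imageI tterms.intros tensor_eq_axioms)
  qed (auto simp: tensor_simps tterms.intros del: equalityI intro!: tensor_class_eqI imageI tterms.intros tensor_eq_axioms)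
qed

lemma bilinear_pure_tensor:
  assumes "module K A" and "module K B"
  shows "bilinear_map K A B (tensor K A B) (pure_tensor K A B)"
  using assms unfolding bilinear_map_def linear_map_def pure_tensor_def
  by (auto simp: tensor_simps tterms.intros del: equalityI intro!: tensor_class_eqI imageI tterms.intros tensor_eq_axioms)

lemma tterm_eval_closed:
  assumes "module K N" and "bilinear_map K A B N f" and "s \<in> tterms K A B"
  shows "tterm_eval N f s \<in> carrier N"
proof -
  interpret N: module K N by fact
  from assms(3) show ?thesis
    using assms(2) by induction (auto simp: bilinear_map_def linear_map_def)
qed

lemma tterm_eval_cong:
  assumes "module K A" and "module K B" and "module K N"
    and f: "bilinear_map K A B N f" and eq: "tensor_eq K A B s t"
  shows "tterm_eval N f s = tterm_eval N f t"
proof -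
  interpret N: module K N by fact
  note closed = tterm_eval_closed[OF assms(3) f]
  from eq show ?thesis
    using f
    by induction
      (auto simp: closed N.M.a_ac N.smult_l_distr N.smult_r_distr N.smult_assoc1
        bilinear_map_def linear_map_def)
qed

lemma tensor_lift_class:
  assumes "module K A" and "module K B" and "module K N"
    and "bilinear_map K A B N f" and "s \<in> tterms K A B"
  shows "tensor_lift N f (tensor_class K A B s) = tterm_eval N f s"
  using tterm_eval_cong[OF assms(1-4) class_rep_tensor_class[OF assms(5)]]
  by (simp add: tensor_lift_def)

theorem tensor_universal:
  assumes "module K A" and "module K B" and "module K N" and f: "bilinear_map K A B N f"
  shows "linear_map K (tensor K A B) N (tensor_lift N f)"
    and "\<lbrakk>a \<in> carrier A; b \<in> carrier B\<rbrakk> \<Longrightarrow> tensor_lift N f (pure_tensor K A B a b) = f a b"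
    and "\<lbrakk>linear_map K (tensor K A B) N g;
        \<And>a b. \<lbrakk>a \<in> carrier A; b \<in> carrier B\<rbrakk> \<Longrightarrow> g (pure_tensor K A B a b) = f a b;
        x \<in> carrier (tensor K A B)\<rbrakk> \<Longrightarrow> g x = tensor_lift N f x"
proof -
  interpret N: module K N by fact
  note lift = tensor_lift_class[OF assms]
  note closed = tterm_eval_closed[OF assms(3) f]
  show "linear_map K (tensor K A B) N (tensor_lift N f)"
    unfolding linear_map_def by (auto simp: tensor_simps lift closed tterms.intros)
  show "tensor_lift N f (pure_tensor K A B a b) = f a b"
    if "a \<in> carrier A" "b \<in> carrier B" for a b
    using that by (simp add: pure_tensor_def lift tterms.intros)
  show "g x = tensor_lift N f x"
    if g: "linear_map K (tensor K A B) N g"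
      and pure_tensor: "\<And>a b. \<lbrakk>a \<in> carrier A; b \<in> carrier B\<rbrakk> \<Longrightarrow> g (pure_tensor K A B a b) = f a b"
      and x: "x \<in> carrier (tensor K A B)"
  proof -
    interpret T: module K "tensor K A B" by (rule module_tensor) fact+
    have cl: "tensor_class K A B s \<in> carrier (tensor K A B)" if "s \<in> tterms K A B" for s
      using that by (simp add: tensor_simps)
    have g_closed: "g X \<in> carrier N" if "X \<in> carrier (tensor K A B)" for X
      using g that by (auto simp: linear_map_def)
    have g_add: "g (X \<oplus>\<^bsub>tensor K A B\<^esub> Y) = g X \<oplus>\<^bsub>N\<^esub> g Y"
      if "X \<in> carrier (tensor K A B)" "Y \<in> carrier (tensor K A B)" for X Y
      using g that by (simp add: linear_map_def)
    have g_smult: "g (c \<odot>\<^bsub>tensor K A B\<^esub> X) = c \<odot>\<^bsub>N\<^esub> g X"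
      if "c \<in> carrier K" "X \<in> carrier (tensor K A B)" for c X
      using g that by (simp add: linear_map_def)
    have g_zero: "g \<zero>\<^bsub>tensor K A B\<^esub> = \<zero>\<^bsub>N\<^esub>"
      using g_smult[OF N.R.zero_closed T.M.zero_closed] g_closed[OF T.M.zero_closed] by simp
    have "g (tensor_class K A B s) = tterm_eval N f s" if "s \<in> tterms K A B" for s
      using that
    proof induction
      case zero
      then show ?case using g_zero by (simp add: tensor_simps)
    next
      case (pure a b)
      then show ?case using pure_tensor[of a b] by (simp add: pure_tensor_def)
    next
      case (add s t)
      then show ?case
        using g_add[OF cl[of s] cl[of t]] by (simp add: tensor_simps)
    next
      case (smult c s)
      then show ?case
        using g_smult[of c, OF _ cl[of s]] by (simp add: tensor_simps)
    qed
    then show ?thesis using x by (auto simp: tensor_simps lift)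
  qed
qed

definition tensor_map ::
  "('k, 'm) ring_scheme \<Rightarrow> ('k, 'c, 'r) module_scheme \<Rightarrow> ('k, 'd, 's) module_scheme \<Rightarrow>
   ('a \<Rightarrow> 'c) \<Rightarrow> ('b \<Rightarrow> 'd) \<Rightarrow> ('k, 'a, 'b) tterm set \<Rightarrow> ('k, 'c, 'd) tterm set"
  where "tensor_map K C D f g =
    tensor_lift (tensor K C D) (\<lambda>a b. pure_tensor K C D (f a) (g b))"

definition tensor_assoc ::
  "('k, 'm) ring_scheme \<Rightarrow> ('k, 'a, 'p) module_scheme \<Rightarrow> ('k, 'b, 'q) module_scheme \<Rightarrow>
   ('k, 'c, 'r) module_scheme \<Rightarrow>
   ('k, ('k, 'a, 'b) tterm set, 'c) tterm set \<Rightarrow> ('k, 'a, ('k, 'b, 'c) tterm set) tterm set"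
  where "tensor_assoc K A B C =
    tensor_lift (tensor K A (tensor K B C))
      (\<lambda>X c. tensor_lift (tensor K A (tensor K B C))
        (\<lambda>a b. pure_tensor K A (tensor K B C) a (pure_tensor K B C b c)) X)"


section \<open>Dendriform algebras\<close>

record ('k, 'a) dendriform = "('k, 'a) module" +
  prec :: "['a, 'a] \<Rightarrow> 'a" (infixl \<open>\<prec>\<index>\<close> 70)
  succ :: "['a, 'a] \<Rightarrow> 'a" (infixl \<open>\<succ>\<index>\<close> 70)

locale dendriform_algebra = field K + module K D
  for K (structure) and D :: "('k, 'a, 'p) dendriform_scheme" (structure) +
  assumes prec_bilinear: "bilinear_map K D D D (prec D)"
    and succ_bilinear: "bilinear_map K D D D (succ D)"
    and prec_prec: "\<lbrakk>x \<in> carrier D; y \<in> carrier D; z \<in> carrier D\<rbrakk> \<Longrightarrow>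
      (x \<prec>\<^bsub>D\<^esub> y) \<prec>\<^bsub>D\<^esub> z = x \<prec>\<^bsub>D\<^esub> (y \<prec>\<^bsub>D\<^esub> z) \<oplus>\<^bsub>D\<^esub> x \<prec>\<^bsub>D\<^esub> (y \<succ>\<^bsub>D\<^esub> z)"
    and succ_prec: "\<lbrakk>x \<in> carrier D; y \<in> carrier D; z \<in> carrier D\<rbrakk> \<Longrightarrow>
      (x \<succ>\<^bsub>D\<^esub> y) \<prec>\<^bsub>D\<^esub> z = x \<succ>\<^bsub>D\<^esub> (y \<prec>\<^bsub>D\<^esub> z)"
    and succ_succ: "\<lbrakk>x \<in> carrier D; y \<in> carrier D; z \<in> carrier D\<rbrakk> \<Longrightarrow>
      x \<succ>\<^bsub>D\<^esub> (y \<succ>\<^bsub>D\<^esub> z) = (x \<succ>\<^bsub>D\<^esub> y) \<succ>\<^bsub>D\<^esub> z \<oplus>\<^bsub>D\<^esub> (x \<prec>\<^bsub>D\<^esub> y) \<succ>\<^bsub>D\<^esub> z"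

text \<open>In a unital dendriform algebra \<open>W = K \<cdot> 1 \<oplus> V\<close> the unit is the record field \<open>one\<close>, and
  \<open>V\<close> is the subspace \<open>aug W\<close>. A linear map on \<open>V \<otimes> W + W \<otimes> V\<close> is a map which is bilinear both
  on \<open>V \<times> W\<close> and on \<open>W \<times> V\<close>; the values of \<open>prec W\<close> and \<open>succ W\<close> outside these
  two sets, in particular at \<open>(1, 1)\<close>, are irrelevant.\<close>

record ('k, 'a) udendriform = "('k, 'a) dendriform" +
  aug :: "'a set"

abbreviation aug_space :: "('k, 'a, 'p) udendriform_scheme \<Rightarrow> ('k, 'a, 'p) udendriform_scheme"
  where "aug_space W \<equiv> W\<lparr>carrier := aug W\<rparr>"

locale unital_dendriform_algebra = field K + module K W
  for K (structure) and W :: "('k, 'a, 'p) udendriform_scheme" (structure) +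
  assumes aug_subset: "aug W \<subseteq> carrier W"
    and unit_closed: "\<one>\<^bsub>W\<^esub> \<in> carrier W"
    and aug_dendriform: "dendriform_algebra K (aug_space W)"
    and direct_sum: "x \<in> carrier W \<Longrightarrow>
      \<exists>!(a, v). a \<in> carrier K \<and> v \<in> aug W \<and> x = a \<odot>\<^bsub>W\<^esub> \<one>\<^bsub>W\<^esub> \<oplus>\<^bsub>W\<^esub> v"
    and prec_bilinear_l: "bilinear_map K (aug_space W) W (aug_space W) (prec W)"
    and prec_bilinear_r: "bilinear_map K W (aug_space W) (aug_space W) (prec W)"
    and succ_bilinear_l: "bilinear_map K (aug_space W) W (aug_space W) (succ W)"
    and succ_bilinear_r: "bilinear_map K W (aug_space W) (aug_space W) (succ W)"
    and one_prec: "x \<in> aug W \<Longrightarrow> \<one>\<^bsub>W\<^esub> \<prec>\<^bsub>W\<^esub> x = \<zero>\<^bsub>W\<^esub>"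
    and succ_one: "x \<in> aug W \<Longrightarrow> x \<succ>\<^bsub>W\<^esub> \<one>\<^bsub>W\<^esub> = \<zero>\<^bsub>W\<^esub>"
    and prec_one: "x \<in> aug W \<Longrightarrow> x \<prec>\<^bsub>W\<^esub> \<one>\<^bsub>W\<^esub> = x"
    and one_succ: "x \<in> aug W \<Longrightarrow> \<one>\<^bsub>W\<^esub> \<succ>\<^bsub>W\<^esub> x = x"

text \<open>The two components of \<open>x = a \<cdot> 1 + v\<close>.\<close>

definition unit_coeff ::
  "('k, 'm) ring_scheme \<Rightarrow> ('k, 'a, 'p) udendriform_scheme \<Rightarrow> 'a \<Rightarrow> 'k"
  where "unit_coeff K W x =
    (THE a. a \<in> carrier K \<and> (\<exists>v\<in>aug W. x = a \<odot>\<^bsub>W\<^esub> \<one>\<^bsub>W\<^esub> \<oplus>\<^bsub>W\<^esub> v))"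

definition aug_part ::
  "('k, 'm) ring_scheme \<Rightarrow> ('k, 'a, 'p) udendriform_scheme \<Rightarrow> 'a \<Rightarrow> 'a"
  where "aug_part K W x =
    (THE v. v \<in> aug W \<and> (\<exists>a\<in>carrier K. x = a \<odot>\<^bsub>W\<^esub> \<one>\<^bsub>W\<^esub> \<oplus>\<^bsub>W\<^esub> v))"

text \<open>The bilinear extensions of \<open>\<prec>\<close> and \<open>\<succ>\<close> to all of \<open>W \<times> W\<close> that
  vanish at \<open>(1, 1)\<close>.\<close>

definition prec0 ::
  "('k, 'm) ring_scheme \<Rightarrow> ('k, 'a, 'p) udendriform_scheme \<Rightarrow> 'a \<Rightarrow> 'a \<Rightarrow> 'a"
  where "prec0 K W x y =
    aug_part K W x \<prec>\<^bsub>W\<^esub> y \<oplus>\<^bsub>W\<^esub> (unit_coeff K W x \<odot>\<^bsub>W\<^esub> \<one>\<^bsub>W\<^esub>) \<prec>\<^bsub>W\<^esub> aug_part K W y"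

definition succ0 ::
  "('k, 'm) ring_scheme \<Rightarrow> ('k, 'a, 'p) udendriform_scheme \<Rightarrow> 'a \<Rightarrow> 'a \<Rightarrow> 'a"
  where "succ0 K W x y =
    aug_part K W x \<succ>\<^bsub>W\<^esub> y \<oplus>\<^bsub>W\<^esub> (unit_coeff K W x \<odot>\<^bsub>W\<^esub> \<one>\<^bsub>W\<^esub>) \<succ>\<^bsub>W\<^esub> aug_part K W y"

text \<open>The product \<open>x * y = x \<prec> y + x \<succ> y\<close>, extended bilinearly by \<open>1 * 1 = 1\<close>.\<close>

definition star ::
  "('k, 'm) ring_scheme \<Rightarrow> ('k, 'a, 'p) udendriform_scheme \<Rightarrow> 'a \<Rightarrow> 'a \<Rightarrow> 'a"
  where "star K W x y =
    prec0 K W x y \<oplus>\<^bsub>W\<^esub> succ0 K W x y \<oplus>\<^bsub>W\<^esub>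
      (unit_coeff K W x \<otimes>\<^bsub>K\<^esub> unit_coeff K W y) \<odot>\<^bsub>W\<^esub> \<one>\<^bsub>W\<^esub>"

definition unitization ::
  "('k, 'm) ring_scheme \<Rightarrow> ('k, 'a, 'p) dendriform_scheme \<Rightarrow> ('k, 'k \<times> 'a) udendriform"
  where "unitization K D =
    \<lparr>carrier = carrier K \<times> carrier D,
     mult = undefined,
     one = (\<one>\<^bsub>K\<^esub>, \<zero>\<^bsub>D\<^esub>),
     zero = (\<zero>\<^bsub>K\<^esub>, \<zero>\<^bsub>D\<^esub>),
     add = (\<lambda>(a, x) (b, y). (a \<oplus>\<^bsub>K\<^esub> b, x \<oplus>\<^bsub>D\<^esub> y)),
     smult = (\<lambda>c (a, x). (c \<otimes>\<^bsub>K\<^esub> a, c \<odot>\<^bsub>D\<^esub> x)),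
     prec = (\<lambda>(a, x) (b, y). (\<zero>\<^bsub>K\<^esub>, b \<odot>\<^bsub>D\<^esub> x \<oplus>\<^bsub>D\<^esub> x \<prec>\<^bsub>D\<^esub> y)),
     succ = (\<lambda>(a, x) (b, y). (\<zero>\<^bsub>K\<^esub>, a \<odot>\<^bsub>D\<^esub> y \<oplus>\<^bsub>D\<^esub> x \<succ>\<^bsub>D\<^esub> y)),
     aug = {\<zero>\<^bsub>K\<^esub>} \<times> carrier D\<rparr>"

lemma unital_dendriform_algebra_unitization:
  assumes "dendriform_algebra K D"
  shows "unital_dendriform_algebra K (unitization K D)"
proof -
  interpret K: field K using assms by (simp add: dendriform_algebra_def)
  interpret M: module K D using assms by (simp add: dendriform_algebra_def)
  interpret D: dendriform_algebra K D by fact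
  have bil:
    "\<And>x y. \<lbrakk>x \<in> carrier D; y \<in> carrier D\<rbrakk> \<Longrightarrow> x \<prec>\<^bsub>D\<^esub> y \<in> carrier D \<and> x \<succ>\<^bsub>D\<^esub> y \<in> carrier D"
    "\<And>x y z. \<lbrakk>x \<in> carrier D; y \<in> carrier D; z \<in> carrier D\<rbrakk> \<Longrightarrow>
      (x \<oplus>\<^bsub>D\<^esub> y) \<prec>\<^bsub>D\<^esub> z = x \<prec>\<^bsub>D\<^esub> z \<oplus>\<^bsub>D\<^esub> y \<prec>\<^bsub>D\<^esub> z \<and>
      z \<prec>\<^bsub>D\<^esub> (x \<oplus>\<^bsub>D\<^esub> y) = z \<prec>\<^bsub>D\<^esub> x \<oplus>\<^bsub>D\<^esub> z \<prec>\<^bsub>D\<^esub> y \<and>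
      (x \<oplus>\<^bsub>D\<^esub> y) \<succ>\<^bsub>D\<^esub> z = x \<succ>\<^bsub>D\<^esub> z \<oplus>\<^bsub>D\<^esub> y \<succ>\<^bsub>D\<^esub> z \<and>
      z \<succ>\<^bsub>D\<^esub> (x \<oplus>\<^bsub>D\<^esub> y) = z \<succ>\<^bsub>D\<^esub> x \<oplus>\<^bsub>D\<^esub> z \<succ>\<^bsub>D\<^esub> y"
    "\<And>c x y. \<lbrakk>c \<in> carrier K; x \<in> carrier D; y \<in> carrier D\<rbrakk> \<Longrightarrow>
      (c \<odot>\<^bsub>D\<^esub> x) \<prec>\<^bsub>D\<^esub> y = c \<odot>\<^bsub>D\<^esub> (x \<prec>\<^bsub>D\<^esub> y) \<and> x \<prec>\<^bsub>D\<^esub> (c \<odot>\<^bsub>D\<^esub> y) = c \<odot>\<^bsub>D\<^esub> (x \<prec>\<^bsub>D\<^esub> y) \<and>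
      (c \<odot>\<^bsub>D\<^esub> x) \<succ>\<^bsub>D\<^esub> y = c \<odot>\<^bsub>D\<^esub> (x \<succ>\<^bsub>D\<^esub> y) \<and> x \<succ>\<^bsub>D\<^esub> (c \<odot>\<^bsub>D\<^esub> y) = c \<odot>\<^bsub>D\<^esub> (x \<succ>\<^bsub>D\<^esub> y)"
    using D.prec_bilinear D.succ_bilinear by (auto simp: bilinear_map_def linear_map_def)
  have zz:
    "\<And>x. x \<in> carrier D \<Longrightarrow> \<zero>\<^bsub>D\<^esub> \<prec>\<^bsub>D\<^esub> x = \<zero>\<^bsub>D\<^esub> \<and> x \<prec>\<^bsub>D\<^esub> \<zero>\<^bsub>D\<^esub> = \<zero>\<^bsub>D\<^esub> \<and>
      \<zero>\<^bsub>D\<^esub> \<succ>\<^bsub>D\<^esub> x = \<zero>\<^bsub>D\<^esub> \<and> x \<succ>\<^bsub>D\<^esub> \<zero>\<^bsub>D\<^esub> = \<zero>\<^bsub>D\<^esub>"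
    using bil(3)[OF K.zero_closed M.M.zero_closed] bil(3)[OF K.zero_closed _ M.M.zero_closed]
    by (simp add: bil(1))
  note simps = unitization_def M.M.a_ac K.a_ac K.m_ac M.smult_l_distr M.smult_r_distr
    M.smult_assoc1 K.l_distr K.r_distr bil zz
  have group: "abelian_group (unitization K D)" "abelian_group (aug_space (unitization K D))"
  proof -
    show "abelian_group (unitization K D)"
    proof (rule abelian_groupI)
      fix x assume "x \<in> carrier (unitization K D)"
      then show "\<exists>y\<in>carrier (unitization K D). y \<oplus>\<^bsub>unitization K D\<^esub> x = \<zero>\<^bsub>unitization K D\<^esub>"
        by (intro bexI[of _ "(\<ominus>\<^bsub>K\<^esub> fst x, \<ominus>\<^bsub>D\<^esub> snd x)"])
          (auto simp: unitization_def M.M.l_neg K.l_neg)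
    qed (auto simp: simps)
    show "abelian_group (aug_space (unitization K D))"
    proof (rule abelian_groupI)
      fix x assume "x \<in> carrier (aug_space (unitization K D))"
      then show "\<exists>y\<in>carrier (aug_space (unitization K D)).
          y \<oplus>\<^bsub>aug_space (unitization K D)\<^esub> x = \<zero>\<^bsub>aug_space (unitization K D)\<^esub>"
        by (intro bexI[of _ "(\<zero>\<^bsub>K\<^esub>, \<ominus>\<^bsub>D\<^esub> snd x)"])
          (auto simp: unitization_def M.M.l_neg K.l_neg)
    qed (auto simp: simps)
  qed
  have "module K (unitization K D)" "module K (aug_space (unitization K D))"
    by (rule moduleI[OF K.is_cring]; use group in \<open>auto simp: simps\<close>)+
  moreover have "c \<odot>\<^bsub>D\<^esub> (d \<odot>\<^bsub>D\<^esub> x) = d \<odot>\<^bsub>D\<^esub> (c \<odot>\<^bsub>D\<^esub> x)"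
    if "c \<in> carrier K" "d \<in> carrier K" "x \<in> carrier D" for c d x
    using that by (metis M.smult_assoc1 K.m_comm)
  moreover have direct_sum: "\<exists>!(a, v). a \<in> carrier K \<and> v \<in> aug W \<and> x = a \<odot>\<^bsub>W\<^esub> \<one>\<^bsub>W\<^esub> \<oplus>\<^bsub>W\<^esub> v"
    if "W = unitization K D" "x \<in> carrier W" for W x
    using that by (intro ex1I[of _ "(fst x, (\<zero>\<^bsub>K\<^esub>, snd x))"]) (auto simp: unitization_def)
  ultimately show ?thesis
    by (intro unital_dendriform_algebra.intro unital_dendriform_algebra_axioms.intro
        dendriform_algebra.intro dendriform_algebra_axioms.intro K.field_axioms direct_sum refl)
      (auto simp: simps bilinear_map_def linear_map_def D.prec_prec D.succ_prec D.succ_succ)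
qed


section \<open>Dendriform bialgebras\<close>

text \<open>\<open>sweedler_prod K W g h X Y\<close> is the sum of all
  \<open>g x\<^sub>(\<^sub>1\<^sub>) y\<^sub>(\<^sub>1\<^sub>) \<otimes> h x\<^sub>(\<^sub>2\<^sub>) y\<^sub>(\<^sub>2\<^sub>)\<close>, where \<open>X\<close> is the sum of all
  \<open>x\<^sub>(\<^sub>1\<^sub>) \<otimes> x\<^sub>(\<^sub>2\<^sub>)\<close> and \<open>Y\<close> the sum of all \<open>y\<^sub>(\<^sub>1\<^sub>) \<otimes> y\<^sub>(\<^sub>2\<^sub>)\<close>.\<close>

definition sweedler_prod ::
  "('k, 'm) ring_scheme \<Rightarrow> ('k, 'a, 'p) module_scheme \<Rightarrow> ('a \<Rightarrow> 'a \<Rightarrow> 'a) \<Rightarrow> ('a \<Rightarrow> 'a \<Rightarrow> 'a) \<Rightarrow>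
   ('k, 'a, 'a) tterm set \<Rightarrow> ('k, 'a, 'a) tterm set \<Rightarrow> ('k, 'a, 'a) tterm set"
  where "sweedler_prod K W g h X Y =
    tensor_lift (tensor K W W) (\<lambda>x1 x2.
      tensor_lift (tensor K W W) (\<lambda>y1 y2. pure_tensor K W W (g x1 y1) (h x2 y2)) Y) X"

text \<open>In \<open>comult_succ\<close> and \<open>comult_prec\<close>, omitting the summand with
  \<open>x\<^sub>(\<^sub>2\<^sub>) = y\<^sub>(\<^sub>2\<^sub>) = 1\<close> amounts to using \<open>succ0\<close> and \<open>prec0\<close>, which vanish
  at \<open>(1, 1)\<close>, on the second tensor factor.\<close>

locale dendriform_bialgebra = unital_dendriform_algebra K W
  for K (structure) and W :: "('k, 'a, 'p) udendriform_scheme" (structure) +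
  fixes \<Delta> :: "'a \<Rightarrow> ('k, 'a, 'a) tterm set"
  assumes comult_linear: "linear_map K W (tensor K W W) \<Delta>"
    and comult_one: "\<Delta> \<one>\<^bsub>W\<^esub> = pure_tensor K W W \<one>\<^bsub>W\<^esub> \<one>\<^bsub>W\<^esub>"
    and comult_coassoc: "x \<in> carrier W \<Longrightarrow>
      tensor_assoc K W W W (tensor_map K (tensor K W W) W \<Delta> (\<lambda>y. y) (\<Delta> x)) =
      tensor_map K W (tensor K W W) (\<lambda>y. y) \<Delta> (\<Delta> x)"
    and counit_l: "x \<in> carrier W \<Longrightarrow>
      tensor_lift W (\<lambda>x1 x2. unit_coeff K W x1 \<odot>\<^bsub>W\<^esub> x2) (\<Delta> x) = x"
    and counit_r: "x \<in> carrier W \<Longrightarrow>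
      tensor_lift W (\<lambda>x1 x2. unit_coeff K W x2 \<odot>\<^bsub>W\<^esub> x1) (\<Delta> x) = x"
    and comult_succ: "\<lbrakk>x \<in> aug W; y \<in> aug W\<rbrakk> \<Longrightarrow>
      \<Delta> (x \<succ>\<^bsub>W\<^esub> y) =
        sweedler_prod K W (star K W) (succ0 K W) (\<Delta> x) (\<Delta> y)
          \<oplus>\<^bsub>tensor K W W\<^esub> pure_tensor K W W (x \<succ>\<^bsub>W\<^esub> y) \<one>\<^bsub>W\<^esub>"
    and comult_prec: "\<lbrakk>x \<in> aug W; y \<in> aug W\<rbrakk> \<Longrightarrow>
      \<Delta> (x \<prec>\<^bsub>W\<^esub> y) =
        sweedler_prod K W (star K W) (prec0 K W) (\<Delta> x) (\<Delta> y)
          \<oplus>\<^bsub>tensor K W W\<^esub> pure_tensor K W W (x \<prec>\<^bsub>W\<^esub> y) \<one>\<^bsub>W\<^esub>"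


section \<open>The free dendriform algebra on a vector space\<close>

text \<open>Again by generators and relations: terms in the elements of \<open>V\<close>, modulo the least
  congruence which contains the vector space axioms, the linearity of \<open>DGen\<close>, the bilinearity of
  the two products and the dendriform axioms. The universal property is
  \<open>free_dendriform_universal\<close> below.\<close>

datatype ('k, 'v) dterm =
    DZero
  | DGen 'v
  | DAdd "('k, 'v) dterm" "('k, 'v) dterm"
  | DSmult 'k "('k, 'v) dterm"
  | DPrec "('k, 'v) dterm" "('k, 'v) dterm"
  | DSucc "('k, 'v) dterm" "('k, 'v) dterm"

inductive_set dterms ::
  "('k, 'm) ring_scheme \<Rightarrow> ('k, 'v, 'p) module_scheme \<Rightarrow> ('k, 'v) dterm set"
  for K V where
  zero: "DZero \<in> dterms K V"
| gen: "v \<in> carrier V \<Longrightarrow> DGen v \<in> dterms K V"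
| add: "\<lbrakk>s \<in> dterms K V; t \<in> dterms K V\<rbrakk> \<Longrightarrow> DAdd s t \<in> dterms K V"
| smult: "\<lbrakk>c \<in> carrier K; s \<in> dterms K V\<rbrakk> \<Longrightarrow> DSmult c s \<in> dterms K V"
| prec: "\<lbrakk>s \<in> dterms K V; t \<in> dterms K V\<rbrakk> \<Longrightarrow> DPrec s t \<in> dterms K V"
| succ: "\<lbrakk>s \<in> dterms K V; t \<in> dterms K V\<rbrakk> \<Longrightarrow> DSucc s t \<in> dterms K V"

inductive dend_eq ::
  "('k, 'm) ring_scheme \<Rightarrow> ('k, 'v, 'p) module_scheme \<Rightarrow>
   ('k, 'v) dterm \<Rightarrow> ('k, 'v) dterm \<Rightarrow> bool"
  for K V where
  refl: "s \<in> dterms K V \<Longrightarrow> dend_eq K V s s"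
| sym: "dend_eq K V s t \<Longrightarrow> dend_eq K V t s"
| trans: "\<lbrakk>dend_eq K V s t; dend_eq K V t u\<rbrakk> \<Longrightarrow> dend_eq K V s u"
| add_cong: "\<lbrakk>dend_eq K V s s'; dend_eq K V t t'\<rbrakk> \<Longrightarrow> dend_eq K V (DAdd s t) (DAdd s' t')"
| smult_cong: "\<lbrakk>c \<in> carrier K; dend_eq K V s s'\<rbrakk> \<Longrightarrow> dend_eq K V (DSmult c s) (DSmult c s')"
| prec_cong: "\<lbrakk>dend_eq K V s s'; dend_eq K V t t'\<rbrakk> \<Longrightarrow> dend_eq K V (DPrec s t) (DPrec s' t')"
| succ_cong: "\<lbrakk>dend_eq K V s s'; dend_eq K V t t'\<rbrakk> \<Longrightarrow> dend_eq K V (DSucc s t) (DSucc s' t')"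
| add_assoc: "\<lbrakk>s \<in> dterms K V; t \<in> dterms K V; u \<in> dterms K V\<rbrakk> \<Longrightarrow>
    dend_eq K V (DAdd (DAdd s t) u) (DAdd s (DAdd t u))"
| add_comm: "\<lbrakk>s \<in> dterms K V; t \<in> dterms K V\<rbrakk> \<Longrightarrow> dend_eq K V (DAdd s t) (DAdd t s)"
| zero_add: "s \<in> dterms K V \<Longrightarrow> dend_eq K V (DAdd DZero s) s"
| smult_zero: "s \<in> dterms K V \<Longrightarrow> dend_eq K V (DSmult \<zero>\<^bsub>K\<^esub> s) DZero"
| smult_one: "s \<in> dterms K V \<Longrightarrow> dend_eq K V (DSmult \<one>\<^bsub>K\<^esub> s) s"
| smult_smult: "\<lbrakk>c \<in> carrier K; d \<in> carrier K; s \<in> dterms K V\<rbrakk> \<Longrightarrow>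
    dend_eq K V (DSmult (c \<otimes>\<^bsub>K\<^esub> d) s) (DSmult c (DSmult d s))"
| smult_l: "\<lbrakk>c \<in> carrier K; d \<in> carrier K; s \<in> dterms K V\<rbrakk> \<Longrightarrow>
    dend_eq K V (DSmult (c \<oplus>\<^bsub>K\<^esub> d) s) (DAdd (DSmult c s) (DSmult d s))"
| smult_r: "\<lbrakk>c \<in> carrier K; s \<in> dterms K V; t \<in> dterms K V\<rbrakk> \<Longrightarrow>
    dend_eq K V (DSmult c (DAdd s t)) (DAdd (DSmult c s) (DSmult c t))"
| gen_add: "\<lbrakk>v \<in> carrier V; w \<in> carrier V\<rbrakk> \<Longrightarrow>
    dend_eq K V (DGen (v \<oplus>\<^bsub>V\<^esub> w)) (DAdd (DGen v) (DGen w))"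
| gen_smult: "\<lbrakk>c \<in> carrier K; v \<in> carrier V\<rbrakk> \<Longrightarrow>
    dend_eq K V (DGen (c \<odot>\<^bsub>V\<^esub> v)) (DSmult c (DGen v))"
| prec_add_l: "\<lbrakk>s \<in> dterms K V; s' \<in> dterms K V; t \<in> dterms K V\<rbrakk> \<Longrightarrow>
    dend_eq K V (DPrec (DAdd s s') t) (DAdd (DPrec s t) (DPrec s' t))"
| prec_add_r: "\<lbrakk>s \<in> dterms K V; t \<in> dterms K V; t' \<in> dterms K V\<rbrakk> \<Longrightarrow>
    dend_eq K V (DPrec s (DAdd t t')) (DAdd (DPrec s t) (DPrec s t'))"
| prec_smult_l: "\<lbrakk>c \<in> carrier K; s \<in> dterms K V; t \<in> dterms K V\<rbrakk> \<Longrightarrow>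
    dend_eq K V (DPrec (DSmult c s) t) (DSmult c (DPrec s t))"
| prec_smult_r: "\<lbrakk>c \<in> carrier K; s \<in> dterms K V; t \<in> dterms K V\<rbrakk> \<Longrightarrow>
    dend_eq K V (DPrec s (DSmult c t)) (DSmult c (DPrec s t))"
| succ_add_l: "\<lbrakk>s \<in> dterms K V; s' \<in> dterms K V; t \<in> dterms K V\<rbrakk> \<Longrightarrow>
    dend_eq K V (DSucc (DAdd s s') t) (DAdd (DSucc s t) (DSucc s' t))"
| succ_add_r: "\<lbrakk>s \<in> dterms K V; t \<in> dterms K V; t' \<in> dterms K V\<rbrakk> \<Longrightarrow>
    dend_eq K V (DSucc s (DAdd t t')) (DAdd (DSucc s t) (DSucc s t'))"
| succ_smult_l: "\<lbrakk>c \<in> carrier K; s \<in> dterms K V; t \<in> dterms K V\<rbrakk> \<Longrightarrow>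
    dend_eq K V (DSucc (DSmult c s) t) (DSmult c (DSucc s t))"
| succ_smult_r: "\<lbrakk>c \<in> carrier K; s \<in> dterms K V; t \<in> dterms K V\<rbrakk> \<Longrightarrow>
    dend_eq K V (DSucc s (DSmult c t)) (DSmult c (DSucc s t))"
| prec_prec: "\<lbrakk>s \<in> dterms K V; t \<in> dterms K V; u \<in> dterms K V\<rbrakk> \<Longrightarrow>
    dend_eq K V (DPrec (DPrec s t) u) (DAdd (DPrec s (DPrec t u)) (DPrec s (DSucc t u)))"
| succ_prec: "\<lbrakk>s \<in> dterms K V; t \<in> dterms K V; u \<in> dterms K V\<rbrakk> \<Longrightarrow>
    dend_eq K V (DPrec (DSucc s t) u) (DSucc s (DPrec t u))"
| succ_succ: "\<lbrakk>s \<in> dterms K V; t \<in> dterms K V; u \<in> dterms K V\<rbrakk> \<Longrightarrow>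
    dend_eq K V (DSucc s (DSucc t u)) (DAdd (DSucc (DSucc s t) u) (DSucc (DPrec s t) u))"

definition dend_class ::
  "('k, 'm) ring_scheme \<Rightarrow> ('k, 'v, 'p) module_scheme \<Rightarrow> ('k, 'v) dterm \<Rightarrow> ('k, 'v) dterm set"
  where "dend_class K V t = {s. dend_eq K V t s}"

definition free_dendriform ::
  "('k, 'm) ring_scheme \<Rightarrow> ('k, 'v, 'p) module_scheme \<Rightarrow> ('k, ('k, 'v) dterm set) dendriform"
  where "free_dendriform K V =
    \<lparr>carrier = dend_class K V ` dterms K V,
     mult = undefined, one = undefined,
     zero = dend_class K V DZero,
     add = (\<lambda>X Y. dend_class K V (DAdd (class_rep X) (class_rep Y))),
     smult = (\<lambda>c X. dend_class K V (DSmult c (class_rep X))),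
     prec = (\<lambda>X Y. dend_class K V (DPrec (class_rep X) (class_rep Y))),
     succ = (\<lambda>X Y. dend_class K V (DSucc (class_rep X) (class_rep Y)))\<rparr>"

definition free_gen ::
  "('k, 'm) ring_scheme \<Rightarrow> ('k, 'v, 'p) module_scheme \<Rightarrow> 'v \<Rightarrow> ('k, 'v) dterm set"
  where "free_gen K V v = dend_class K V (DGen v)"

primrec dterm_eval ::
  "('k, 'e, 'r) dendriform_scheme \<Rightarrow> ('v \<Rightarrow> 'e) \<Rightarrow> ('k, 'v) dterm \<Rightarrow> 'e" where
  "dterm_eval E f DZero = \<zero>\<^bsub>E\<^esub>"
| "dterm_eval E f (DGen v) = f v"
| "dterm_eval E f (DAdd s t) = dterm_eval E f s \<oplus>\<^bsub>E\<^esub> dterm_eval E f t"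
| "dterm_eval E f (DSmult c s) = c \<odot>\<^bsub>E\<^esub> dterm_eval E f s"
| "dterm_eval E f (DPrec s t) = dterm_eval E f s \<prec>\<^bsub>E\<^esub> dterm_eval E f t"
| "dterm_eval E f (DSucc s t) = dterm_eval E f s \<succ>\<^bsub>E\<^esub> dterm_eval E f t"

definition dend_hom ::
  "('k, 'm) ring_scheme \<Rightarrow> ('k, 'a, 'p) dendriform_scheme \<Rightarrow> ('k, 'b, 'q) dendriform_scheme \<Rightarrow>
   ('a \<Rightarrow> 'b) \<Rightarrow> bool"
  where "dend_hom K D E f \<longleftrightarrow> linear_map K D E f \<and>
    (\<forall>x\<in>carrier D. \<forall>y\<in>carrier D. f (x \<prec>\<^bsub>D\<^esub> y) = f x \<prec>\<^bsub>E\<^esub> f y \<and> f (x \<succ>\<^bsub>D\<^esub> y) = f x \<succ>\<^bsub>E\<^esub> f y)"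

lemmas dend_eq_axioms = dend_eq.add_assoc dend_eq.add_comm dend_eq.zero_add
  dend_eq.smult_one dend_eq.smult_smult dend_eq.smult_l dend_eq.smult_r
  dend_eq.gen_add dend_eq.gen_smult
  dend_eq.prec_add_l dend_eq.prec_add_r dend_eq.prec_smult_l dend_eq.prec_smult_r
  dend_eq.succ_add_l dend_eq.succ_add_r dend_eq.succ_smult_l dend_eq.succ_smult_r
  dend_eq.prec_prec dend_eq.succ_prec dend_eq.succ_succ

lemma dend_eq_terms:
  assumes "module K V" and "dend_eq K V s t"
  shows "s \<in> dterms K V" and "t \<in> dterms K V"
proof -
  interpret V: module K V by fact
  from assms(2) have "s \<in> dterms K V \<and> t \<in> dterms K V"
    by induction (auto intro!: dterms.intros)
  then show "s \<in> dterms K V" and "t \<in> dterms K V" by auto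
qed

lemma dend_class_eqI: "dend_eq K V s t \<Longrightarrow> dend_class K V s = dend_class K V t"
  unfolding dend_class_def
  by (auto dest: dend_eq.trans[of K V s t]
      dend_eq.trans[OF dend_eq.sym, of K V s t])

lemma class_rep_dend_class:
  assumes "s \<in> dterms K V"
  shows "dend_eq K V s (class_rep (dend_class K V s))"
proof -
  have "s \<in> dend_class K V s"
    using assms by (simp add: dend_class_def dend_eq.refl)
  then have "class_rep (dend_class K V s) \<in> dend_class K V s"
    unfolding class_rep_def by (rule someI)
  then show ?thesis by (simp add: dend_class_def)
qed

lemma free_dendriform_simps:
  "carrier (free_dendriform K V) = dend_class K V ` dterms K V"
  "\<zero>\<^bsub>free_dendriform K V\<^esub> = dend_class K V DZero"
  "\<lbrakk>s \<in> dterms K V; t \<in> dterms K V\<rbrakk> \<Longrightarrow>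
    dend_class K V s \<oplus>\<^bsub>free_dendriform K V\<^esub> dend_class K V t = dend_class K V (DAdd s t)"
  "\<lbrakk>c \<in> carrier K; s \<in> dterms K V\<rbrakk> \<Longrightarrow>
    c \<odot>\<^bsub>free_dendriform K V\<^esub> dend_class K V s = dend_class K V (DSmult c s)"
  "\<lbrakk>s \<in> dterms K V; t \<in> dterms K V\<rbrakk> \<Longrightarrow>
    dend_class K V s \<prec>\<^bsub>free_dendriform K V\<^esub> dend_class K V t = dend_class K V (DPrec s t)"
  "\<lbrakk>s \<in> dterms K V; t \<in> dterms K V\<rbrakk> \<Longrightarrow>
    dend_class K V s \<succ>\<^bsub>free_dendriform K V\<^esub> dend_class K V t = dend_class K V (DSucc s t)"
  by (auto simp: free_dendriform_def intro!: dend_class_eqI[OF dend_eq.sym]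
      dend_eq.add_cong dend_eq.smult_cong dend_eq.prec_cong dend_eq.succ_cong
      class_rep_dend_class)

lemma module_free_dendriform:
  assumes "module K V"
  shows "module K (free_dendriform K V)"
proof -
  interpret V: module K V by fact
  show ?thesis
  proof (rule moduleI)
    show "cring K" by (rule V.is_cring)
    show "abelian_group (free_dendriform K V)"
    proof (rule abelian_groupI)
      fix x assume "x \<in> carrier (free_dendriform K V)"
      then obtain s where s: "s \<in> dterms K V" "x = dend_class K V s"
        by (auto simp: free_dendriform_simps)
      have m1: "\<ominus>\<^bsub>K\<^esub> \<one>\<^bsub>K\<^esub> \<in> carrier K" by simp
      have "dend_eq K V (DAdd (DSmult (\<ominus>\<^bsub>K\<^esub> \<one>\<^bsub>K\<^esub>) s) s)
          (DAdd (DSmult (\<ominus>\<^bsub>K\<^esub> \<one>\<^bsub>K\<^esub>) s) (DSmult \<one>\<^bsub>K\<^esub> s))"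
        using s m1 by (auto intro!: dend_eq.add_cong dend_eq.refl dterms.intros
            dend_eq.sym[OF dend_eq.smult_one])
      moreover have "dend_eq K V (DAdd (DSmult (\<ominus>\<^bsub>K\<^esub> \<one>\<^bsub>K\<^esub>) s) (DSmult \<one>\<^bsub>K\<^esub> s)) DZero"
        using dend_eq.smult_l[of "\<ominus>\<^bsub>K\<^esub> \<one>\<^bsub>K\<^esub>" K "\<one>\<^bsub>K\<^esub>" s V] s m1
        by (simp add: V.R.l_neg)
          (rule dend_eq.trans[OF dend_eq.sym dend_eq.smult_zero])
      ultimately have "dend_eq K V (DAdd (DSmult (\<ominus>\<^bsub>K\<^esub> \<one>\<^bsub>K\<^esub>) s) s) DZero"
        by (rule dend_eq.trans)
      then have "dend_class K V (DSmult (\<ominus>\<^bsub>K\<^esub> \<one>\<^bsub>K\<^esub>) s) \<oplus>\<^bsub>free_dendriform K V\<^esub> x = \<zero>\<^bsub>free_dendriform K V\<^esub>"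
        using s m1 by (auto simp: free_dendriform_simps dterms.intros intro!: dend_class_eqI)
      then show "\<exists>y\<in>carrier (free_dendriform K V). y \<oplus>\<^bsub>free_dendriform K V\<^esub> x = \<zero>\<^bsub>free_dendriform K V\<^esub>"
        by (rule bexI) (use s m1 in \<open>simp add: free_dendriform_simps dterms.intros\<close>)
    qed (auto simp: free_dendriform_simps dterms.intros del: equalityI intro!: dend_class_eqI imageI dterms.intros dend_eq_axioms)
  qed (auto simp: free_dendriform_simps dterms.intros del: equalityI intro!: dend_class_eqI imageI dterms.intros dend_eq_axioms)
qed

lemma dendriform_algebra_free_dendriform:
  assumes "field K" and "module K V"
  shows "dendriform_algebra K (free_dendriform K V)"
  by (intro dendriform_algebra.intro dendriform_algebra_axioms.intro assms
      module_free_dendriform[OF assms(2)])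
    (auto simp: bilinear_map_def linear_map_def free_dendriform_simps dterms.intros
      del: equalityI intro!: dend_class_eqI imageI dterms.intros dend_eq_axioms)

lemma linear_free_gen:
  assumes "module K V"
  shows "linear_map K V (free_dendriform K V) (free_gen K V)"
  using assms unfolding linear_map_def free_gen_def
  by (auto simp: free_dendriform_simps dterms.intros del: equalityI intro!: dend_class_eqI imageI dterms.intros dend_eq_axioms)

lemma dterm_eval_closed:
  assumes "dendriform_algebra K E" and "linear_map K V E f" and "s \<in> dterms K V"
  shows "dterm_eval E f s \<in> carrier E"
proof -
  interpret E: dendriform_algebra K E by fact
  from assms(3) show ?thesis
    using assms(2) E.prec_bilinear E.succ_bilinear
    by induction (auto simp: bilinear_map_def linear_map_def)
qed

lemma dterm_eval_cong:
  assumes "module K V" and "dendriform_algebra K E"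
    and f: "linear_map K V E f" and eq: "dend_eq K V s t"
  shows "dterm_eval E f s = dterm_eval E f t"
proof -
  interpret E: dendriform_algebra K E by fact
  note closed = dterm_eval_closed[OF assms(2) f]
  from eq show ?thesis
    using f E.prec_bilinear E.succ_bilinear
    by induction
      (auto simp: closed E.M.a_ac E.smult_l_distr E.smult_r_distr
        E.smult_assoc1 E.prec_prec E.succ_prec E.succ_succ bilinear_map_def linear_map_def)
qed

theorem free_dendriform_universal:
  assumes "module K V" and "dendriform_algebra K E" and f: "linear_map K V E f"
  shows "\<exists>!g. g \<in> extensional (carrier (free_dendriform K V)) \<and>
    dend_hom K (free_dendriform K V) E g \<and> (\<forall>v\<in>carrier V. g (free_gen K V v) = f v)"
proof -
  interpret V: module K V by fact
  interpret E: dendriform_algebra K E by fact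
  interpret D: module K "free_dendriform K V" by (rule module_free_dendriform) fact
  let ?D = "free_dendriform K V"
  note closed = dterm_eval_closed[OF assms(2) f]
  have cl: "dend_class K V s \<in> carrier ?D" if "s \<in> dterms K V" for s
    using that by (simp add: free_dendriform_simps)
  define g where "g = restrict (\<lambda>X. dterm_eval E f (class_rep X)) (carrier ?D)"
  have lift: "g (dend_class K V s) = dterm_eval E f s" if "s \<in> dterms K V" for s
    using dterm_eval_cong[OF assms class_rep_dend_class[OF that]] cl[OF that]
    by (simp add: g_def)
  have "dend_hom K ?D E g \<and> (\<forall>v\<in>carrier V. g (free_gen K V v) = f v)"
    unfolding dend_hom_def linear_map_def free_gen_def
    by (auto simp: free_dendriform_simps lift closed dterms.intros)
  moreover have "g \<in> extensional (carrier ?D)" by (simp add: g_def)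
  moreover have "h = g"
    if h: "h \<in> extensional (carrier ?D)" "dend_hom K ?D E h"
      "\<forall>v\<in>carrier V. h (free_gen K V v) = f v" for h
  proof (rule extensionalityI[OF h(1)])
    show "g \<in> extensional (carrier ?D)" by (simp add: g_def)
    have lin: "linear_map K ?D E h" using h(2) by (simp add: dend_hom_def)
    have h_closed: "h X \<in> carrier E" if "X \<in> carrier ?D" for X
      using lin that by (auto simp: linear_map_def)
    have h_add: "h (X \<oplus>\<^bsub>?D\<^esub> Y) = h X \<oplus>\<^bsub>E\<^esub> h Y"
      if "X \<in> carrier ?D" "Y \<in> carrier ?D" for X Y
      using lin that by (simp add: linear_map_def)
    have h_smult: "h (c \<odot>\<^bsub>?D\<^esub> X) = c \<odot>\<^bsub>E\<^esub> h X"
      if "c \<in> carrier K" "X \<in> carrier ?D" for c X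
      using lin that by (simp add: linear_map_def)
    have h_mult: "h (X \<prec>\<^bsub>?D\<^esub> Y) = h X \<prec>\<^bsub>E\<^esub> h Y" "h (X \<succ>\<^bsub>?D\<^esub> Y) = h X \<succ>\<^bsub>E\<^esub> h Y"
      if "X \<in> carrier ?D" "Y \<in> carrier ?D" for X Y
      using h(2) that by (simp_all add: dend_hom_def)
    have h_zero: "h \<zero>\<^bsub>?D\<^esub> = \<zero>\<^bsub>E\<^esub>"
      using h_smult[OF V.R.zero_closed D.M.zero_closed] h_closed[OF D.M.zero_closed] by simp
    have "h (dend_class K V s) = dterm_eval E f s" if "s \<in> dterms K V" for s
      using that
    proof induction
      case zero
      then show ?case using h_zero by (simp add: free_dendriform_simps)
    next
      case (gen v)
      then show ?case using h(3) by (simp add: free_gen_def)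
    next
      case (add s t)
      then show ?case
        using h_add[OF cl[of s] cl[of t]] by (simp add: free_dendriform_simps)
    next
      case (smult c s)
      then show ?case
        using h_smult[of c, OF _ cl[of s]] by (simp add: free_dendriform_simps)
    next
      case (prec s t)
      then show ?case
        using h_mult(1)[OF cl[of s] cl[of t]] by (simp add: free_dendriform_simps)
    next
      case (succ s t)
      then show ?case
        using h_mult(2)[OF cl[of s] cl[of t]] by (simp add: free_dendriform_simps)
    qed
    then show "h x = g x" if "x \<in> carrier ?D" for x
      using that lift by (auto simp: free_dendriform_simps)
  qed
  ultimately show ?thesis by blast
qed


section \<open>The Loday--Ronco coproduct\<close>

abbreviation free_unital ::
  "('k, 'm) ring_scheme \<Rightarrow> ('k, 'v, 'p) module_scheme \<Rightarrow>
   ('k, 'k \<times> ('k, 'v) dterm set) udendriform"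
  where "free_unital K V \<equiv> unitization K (free_dendriform K V)"

definition vee ::
  "('k, 'm) ring_scheme \<Rightarrow> ('k, 'v, 'p) module_scheme \<Rightarrow> 'v \<Rightarrow>
   'k \<times> ('k, 'v) dterm set \<Rightarrow> 'k \<times> ('k, 'v) dterm set \<Rightarrow> 'k \<times> ('k, 'v) dterm set"
  where "vee K V v x y =
    (x \<succ>\<^bsub>free_unital K V\<^esub> (\<zero>\<^bsub>K\<^esub>, free_gen K V v)) \<prec>\<^bsub>free_unital K V\<^esub> y"

definition is_LR_coproduct ::
  "('k, 'm) ring_scheme \<Rightarrow> ('k, 'v, 'p) module_scheme \<Rightarrow>
   ('k \<times> ('k, 'v) dterm set \<Rightarrow>
     ('k, 'k \<times> ('k, 'v) dterm set, 'k \<times> ('k, 'v) dterm set) tterm set) \<Rightarrow> bool"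
  where "is_LR_coproduct K V \<Delta> \<longleftrightarrow>
    (let W = free_unital K V; WW = tensor K W W in
      linear_map K W WW \<Delta> \<and>
      \<Delta> \<one>\<^bsub>W\<^esub> = pure_tensor K W W \<one>\<^bsub>W\<^esub> \<one>\<^bsub>W\<^esub> \<and>
      (\<forall>x\<in>carrier W. \<forall>y\<in>carrier W. \<forall>v\<in>carrier V.
        \<Delta> (vee K V v x y) =
          pure_tensor K W W (vee K V v x y) \<one>\<^bsub>W\<^esub>
            \<oplus>\<^bsub>WW\<^esub> sweedler_prod K W (star K W) (vee K V v) (\<Delta> x) (\<Delta> y)))"

text \<open>Restricting to extensional functions makes the coproduct unique as a HOL function.\<close>

definition LR_coproduct ::
  "('k, 'm) ring_scheme \<Rightarrow> ('k, 'v, 'p) module_scheme \<Rightarrow>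
   'k \<times> ('k, 'v) dterm set \<Rightarrow>
     ('k, 'k \<times> ('k, 'v) dterm set, 'k \<times> ('k, 'v) dterm set) tterm set"
  where "LR_coproduct K V =
    (THE \<Delta>. \<Delta> \<in> extensional (carrier (free_unital K V)) \<and> is_LR_coproduct K V \<Delta>)"

end

theory Submission
  imports Defs
begin

text \<open>
  Extend \<open>\<prec>\<close> and \<open>\<succ>\<close> to all of \<open>W \<times> W\<close> by \<open>1 \<prec> 1 = 1 \<succ> 1 = 0\<close>. With the full product
  \<open>x * y = x \<prec> y + x \<succ> y + \<epsilon>(x) \<epsilon>(y) 1\<close> the dendriform axioms then read
  \<open>(x \<prec> y) \<prec> z = x \<prec> (y * z)\<close>, \<open>(x \<succ> y) \<prec> z = x \<succ> (y \<prec> z)\<close>, \<open>(x * y) \<succ> z = x \<succ> (y \<succ> z)\<close> and hold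
  without exception. Such structures are closed under tensor products, with
  \<open>(a \<otimes> b) \<prec> (a' \<otimes> b') = (a * a') \<otimes> (b \<prec> b') + \<epsilon>(b) \<epsilon>(b') (a \<prec> a') \<otimes> 1\<close>. The morphism \<open>\<Delta>\<close> from the free
  algebra with \<open>\<Delta> v = v \<otimes> 1 + 1 \<otimes> v\<close> satisfies the compatibility axioms by construction of these
  products, and counitality and coassociativity because morphisms out of the free algebra are
  determined by their values on generators. It satisfies the Loday--Ronco recursion, which has at
  most one solution because the elements obtained from \<open>1\<close> by \<open>\<or>\<close> span the free algebra.
\<close>

section \<open>Multilinear maps\<close>

lemma linear_mapI:
  assumes "\<And>x. x \<in> carrier M \<Longrightarrow> f x \<in> carrier N"
    and "\<And>x y. \<lbrakk>x \<in> carrier M; y \<in> carrier M\<rbrakk> \<Longrightarrow> f (x \<oplus>\<^bsub>M\<^esub> y) = f x \<oplus>\<^bsub>N\<^esub> f y"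
    and "\<And>a x. \<lbrakk>a \<in> carrier K; x \<in> carrier M\<rbrakk> \<Longrightarrow> f (a \<odot>\<^bsub>M\<^esub> x) = a \<odot>\<^bsub>N\<^esub> f x"
  shows "linear_map K M N f"
  using assms by (auto simp: linear_map_def)

lemma linear_mapD:
  assumes "linear_map K M N f"
  shows "x \<in> carrier M \<Longrightarrow> f x \<in> carrier N"
    and "\<lbrakk>x \<in> carrier M; y \<in> carrier M\<rbrakk> \<Longrightarrow> f (x \<oplus>\<^bsub>M\<^esub> y) = f x \<oplus>\<^bsub>N\<^esub> f y"
    and "\<lbrakk>a \<in> carrier K; x \<in> carrier M\<rbrakk> \<Longrightarrow> f (a \<odot>\<^bsub>M\<^esub> x) = a \<odot>\<^bsub>N\<^esub> f x"
  using assms by (auto simp: linear_map_def)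

lemma linear_map_zero:
  assumes "module K M" "module K N" "linear_map K M N f"
  shows "f \<zero>\<^bsub>M\<^esub> = \<zero>\<^bsub>N\<^esub>"
proof -
  interpret M: module K M by fact
  interpret N: module K N by fact
  show ?thesis
    using linear_mapD(3)[OF assms(3) M.R.zero_closed M.M.zero_closed]
      linear_mapD(1)[OF assms(3) M.M.zero_closed] by simp
qed

lemma bilinear_mapI:
  assumes "\<And>x. x \<in> carrier L \<Longrightarrow> linear_map K M N (f x)"
    and "\<And>y. y \<in> carrier M \<Longrightarrow> linear_map K L N (\<lambda>x. f x y)"
  shows "bilinear_map K L M N f"
  using assms by (auto simp: bilinear_map_def)

lemma bilinear_mapD:
  assumes "bilinear_map K L M N f"
  shows "x \<in> carrier L \<Longrightarrow> linear_map K M N (f x)"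
    and "y \<in> carrier M \<Longrightarrow> linear_map K L N (\<lambda>x. f x y)"
    and "\<lbrakk>x \<in> carrier L; y \<in> carrier M\<rbrakk> \<Longrightarrow> f x y \<in> carrier N"
  using assms by (auto simp: bilinear_map_def linear_map_def)

lemma linear_map_id: "linear_map K M M (\<lambda>x. x)"
  by (simp add: linear_map_def)

lemma linear_map_comp:
  assumes "linear_map K M N g" "linear_map K L M f"
  shows "linear_map K L N (\<lambda>x. g (f x))"
  by (rule linear_mapI) (simp_all add: linear_mapD[OF assms(1)] linear_mapD[OF assms(2)])

lemma linear_map_bilinear_left:
  assumes "bilinear_map K L M N f" "linear_map K P L g" "y \<in> carrier M"
  shows "linear_map K P N (\<lambda>x. f (g x) y)"
  using linear_map_comp[OF bilinear_mapD(2)[OF assms(1,3)] assms(2)] .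

lemma linear_map_bilinear_right:
  assumes "bilinear_map K L M N f" "x \<in> carrier L" "linear_map K P M g"
  shows "linear_map K P N (\<lambda>y. f x (g y))"
  using linear_map_comp[OF bilinear_mapD(1)[OF assms(1,2)] assms(3)] .

lemma linear_map_add:
  assumes "module K N" "linear_map K M N f" "linear_map K M N g"
  shows "linear_map K M N (\<lambda>x. f x \<oplus>\<^bsub>N\<^esub> g x)"
proof -
  interpret N: module K N by fact
  note fg = linear_mapD[OF assms(2)] linear_mapD[OF assms(3)]
  show ?thesis
    by (rule linear_mapI) (auto simp: fg N.M.a_ac N.smult_r_distr)
qed

lemma bilinear_map_add:
  assumes "module K N" "bilinear_map K L M N f" "bilinear_map K L M N g"
  shows "bilinear_map K L M N (\<lambda>x y. f x y \<oplus>\<^bsub>N\<^esub> g x y)"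
  using assms by (auto simp: bilinear_map_def intro: linear_map_add)

lemma bilinear_map_comp:
  assumes "bilinear_map K L M N f" "linear_map K L' L g" "linear_map K M' M h"
  shows "bilinear_map K L' M' N (\<lambda>x y. f (g x) (h y))"
proof (rule bilinear_mapI)
  show "linear_map K M' N (\<lambda>y. f (g x) (h y))" if "x \<in> carrier L'" for x
    by (rule linear_map_bilinear_right[OF assms(1) linear_mapD(1)[OF assms(2) that] assms(3)])
  show "linear_map K L' N (\<lambda>x. f (g x) (h y))" if "y \<in> carrier M'" for y
    by (rule linear_map_bilinear_left[OF assms(1,2) linear_mapD(1)[OF assms(3) that]])
qed

lemma bilinear_map_comp_linear:
  assumes "linear_map K N P g" "bilinear_map K L M N f"
  shows "bilinear_map K L M P (\<lambda>x y. g (f x y))"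
  by (rule bilinear_mapI; rule linear_map_comp[OF assms(1)])
    (simp_all add: bilinear_mapD[OF assms(2)])

text \<open>The field as a module over itself. Scalar-valued maps such as counits thereby fall under
  \<open>linear_map\<close>, and two of them on a tensor product can be compared by
  \<open>tensor_ext\<close>.\<close>

definition regular_module :: "('k, 'm) ring_scheme \<Rightarrow> ('k, 'k) module"
  where "regular_module K = \<lparr>carrier = carrier K, mult = mult K, one = \<one>\<^bsub>K\<^esub>, zero = \<zero>\<^bsub>K\<^esub>,
    add = add K, smult = mult K\<rparr>"

lemma regular_module_simps [simp]:
  "carrier (regular_module K) = carrier K"
  "\<zero>\<^bsub>regular_module K\<^esub> = \<zero>\<^bsub>K\<^esub>"
  "a \<oplus>\<^bsub>regular_module K\<^esub> b = a \<oplus>\<^bsub>K\<^esub> b"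
  "a \<odot>\<^bsub>regular_module K\<^esub> b = a \<otimes>\<^bsub>K\<^esub> b"
  by (simp_all add: regular_module_def)

lemma module_regular_module:
  assumes "cring K"
  shows "module K (regular_module K)"
proof -
  interpret cring K by fact
  have "abelian_group (regular_module K)"
  proof (rule abelian_groupI)
    show "\<exists>y\<in>carrier (regular_module K). y \<oplus>\<^bsub>regular_module K\<^esub> x = \<zero>\<^bsub>regular_module K\<^esub>"
      if "x \<in> carrier (regular_module K)" for x
      by (rule bexI[of _ "\<ominus>\<^bsub>K\<^esub> x"]) (use that in \<open>simp_all add: l_neg\<close>)
  qed (simp_all add: a_ac)
  then show ?thesis
    by (intro moduleI assms) (auto simp: l_distr r_distr m_assoc)
qed

lemma bilinear_map_smult:
  assumes "module K M"
  shows "bilinear_map K (regular_module K) M M (smult M)"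
proof -
  interpret M: module K M by fact
  \<comment> \<open>Homogeneity in the vector argument needs the two scalars to commute.\<close>
  have "c \<odot>\<^bsub>M\<^esub> (d \<odot>\<^bsub>M\<^esub> x) = d \<odot>\<^bsub>M\<^esub> (c \<odot>\<^bsub>M\<^esub> x)"
    if "c \<in> carrier K" "d \<in> carrier K" "x \<in> carrier M" for c d x
    using that by (metis M.smult_assoc1 M.R.m_comm)
  then show ?thesis
    by (auto simp: bilinear_map_def linear_map_def M.smult_l_distr M.smult_r_distr M.smult_assoc1)
qed

section \<open>Products on tensor products\<close>

lemma pure_tensor_closed:
  "\<lbrakk>a \<in> carrier A; b \<in> carrier B\<rbrakk> \<Longrightarrow> pure_tensor K A B a b \<in> carrier (tensor K A B)"
  by (auto simp: pure_tensor_def tensor_simps intro: tterms.intros)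

lemma pure_tensor_linear:
  assumes "module K A" "module K B"
  shows "b \<in> carrier B \<Longrightarrow> linear_map K A (tensor K A B) (\<lambda>a. pure_tensor K A B a b)"
    and "a \<in> carrier A \<Longrightarrow> linear_map K B (tensor K A B) (pure_tensor K A B a)"
  using bilinear_mapD[OF bilinear_pure_tensor[OF assms]] by auto

lemma pure_tensor_zero:
  assumes "module K A" "module K B"
  shows "b \<in> carrier B \<Longrightarrow> pure_tensor K A B \<zero>\<^bsub>A\<^esub> b = \<zero>\<^bsub>tensor K A B\<^esub>"
    and "a \<in> carrier A \<Longrightarrow> pure_tensor K A B a \<zero>\<^bsub>B\<^esub> = \<zero>\<^bsub>tensor K A B\<^esub>"
  using linear_map_zero[OF assms(1) module_tensor[OF assms] pure_tensor_linear(1)[OF assms]]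
    linear_map_zero[OF assms(2) module_tensor[OF assms] pure_tensor_linear(2)[OF assms]]
  by auto

text \<open>By the uniqueness half of the universal property, both maps are the lift of one bilinear
  map, their common restriction to pure tensors.\<close>

lemma tensor_ext:
  assumes "module K A" "module K B" "module K N"
    and "linear_map K (tensor K A B) N f" "linear_map K (tensor K A B) N g"
    and "\<And>a b. \<lbrakk>a \<in> carrier A; b \<in> carrier B\<rbrakk> \<Longrightarrow>
      f (pure_tensor K A B a b) = g (pure_tensor K A B a b)"
    and "X \<in> carrier (tensor K A B)"
  shows "f X = g X"
proof -
  have bil: "bilinear_map K A B N (\<lambda>a b. f (pure_tensor K A B a b))"
    by (rule bilinear_map_comp_linear[OF assms(4) bilinear_pure_tensor[OF assms(1,2)]])
  show ?thesis
    using tensor_universal(3)[OF assms(1-3) bil assms(4) _ assms(7)]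
      tensor_universal(3)[OF assms(1-3) bil assms(5) _ assms(7)] assms(6)
    by simp
qed

lemma tensor_bilinear_ext:
  assumes mod: "module K A" "module K B" "module K C" "module K D" "module K N"
    and F: "bilinear_map K (tensor K A B) (tensor K C D) N F"
    and G: "bilinear_map K (tensor K A B) (tensor K C D) N G"
    and pure: "\<And>a b c d. \<lbrakk>a \<in> carrier A; b \<in> carrier B; c \<in> carrier C; d \<in> carrier D\<rbrakk> \<Longrightarrow>
      F (pure_tensor K A B a b) (pure_tensor K C D c d) =
      G (pure_tensor K A B a b) (pure_tensor K C D c d)"
    and XY: "X \<in> carrier (tensor K A B)" "Y \<in> carrier (tensor K C D)"
  shows "F X Y = G X Y"
proof -
  have "F (pure_tensor K A B a b) Y = G (pure_tensor K A B a b) Y"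
    if "a \<in> carrier A" "b \<in> carrier B" for a b
    by (rule tensor_ext[OF mod(3-5) bilinear_mapD(1)[OF F] bilinear_mapD(1)[OF G] _ XY(2)])
      (use that pure in \<open>simp_all add: pure_tensor_closed\<close>)
  then show ?thesis
    by (rule tensor_ext[OF mod(1,2,5) bilinear_mapD(2)[OF F XY(2)] bilinear_mapD(2)[OF G XY(2)] _ XY(1)])
qed

text \<open>Linearity in a parameter survives lifting: additivity and homogeneity, for fixed
  parameters, are equalities of linear maps in \<open>X\<close>, so pure tensors decide them. This
  supplies the second variable of the iterated lifts \<open>tensor_prod\<close> and
  \<open>tensor_assoc\<close>.\<close>

lemma linear_map_tensor_lift:
  assumes mod: "module K A" "module K B" "module K N"
    and F: "\<And>y. y \<in> carrier M \<Longrightarrow> bilinear_map K A B N (F y)"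
    and lin: "\<And>a b. \<lbrakk>a \<in> carrier A; b \<in> carrier B\<rbrakk> \<Longrightarrow> linear_map K M N (\<lambda>y. F y a b)"
    and M: "module K M"
    and X: "X \<in> carrier (tensor K A B)"
  shows "linear_map K M N (\<lambda>y. tensor_lift N (F y) X)"
proof -
  interpret M: module K M by fact
  interpret N: module K N by fact
  note tu = tensor_universal(1,2)[OF mod F]
  show ?thesis
  proof (rule linear_mapI)
    show "tensor_lift N (F y) X \<in> carrier N" if "y \<in> carrier M" for y
      using linear_mapD(1)[OF tu(1) X] that .
    show "tensor_lift N (F (x \<oplus>\<^bsub>M\<^esub> y)) X = tensor_lift N (F x) X \<oplus>\<^bsub>N\<^esub> tensor_lift N (F y) X"
      if xy: "x \<in> carrier M" "y \<in> carrier M" for x y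
      by (rule tensor_ext[OF mod tu(1) linear_map_add[OF mod(3) tu(1) tu(1)] _ X])
        (use xy in \<open>simp_all add: tu(2) linear_mapD[OF lin]\<close>)
    show "tensor_lift N (F (c \<odot>\<^bsub>M\<^esub> y)) X = c \<odot>\<^bsub>N\<^esub> tensor_lift N (F y) X"
      if cy: "c \<in> carrier K" "y \<in> carrier M" for c y
      by (rule tensor_ext[OF mod tu(1)
            linear_map_bilinear_right[OF bilinear_map_smult[OF mod(3)] _ tu(1)] _ X])
        (use cy in \<open>simp_all add: tu(2) linear_mapD[OF lin]\<close>)
  qed
qed

text \<open>The form of \<open>sweedler_prod\<close> with two different factors. Coassociativity
  needs it, because iterated tensor products have factors of different types.\<close>

definition tensor_prod ::
  "('k, 'm) ring_scheme \<Rightarrow> ('k, 'a, 'p) module_scheme \<Rightarrow> ('k, 'b, 'q) module_scheme \<Rightarrow>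
   ('a \<Rightarrow> 'a \<Rightarrow> 'a) \<Rightarrow> ('b \<Rightarrow> 'b \<Rightarrow> 'b) \<Rightarrow>
   ('k, 'a, 'b) tterm set \<Rightarrow> ('k, 'a, 'b) tterm set \<Rightarrow> ('k, 'a, 'b) tterm set"
  where "tensor_prod K A B g h X Y =
    tensor_lift (tensor K A B) (\<lambda>x1 x2.
      tensor_lift (tensor K A B) (\<lambda>y1 y2. pure_tensor K A B (g x1 y1) (h x2 y2)) Y) X"

lemma sweedler_prod_eq: "sweedler_prod K W = tensor_prod K W W"
  by (simp add: sweedler_prod_def tensor_prod_def fun_eq_iff)

lemma tensor_prod:
  assumes A: "module K A" and B: "module K B"
    and g: "bilinear_map K A A A g" and h: "bilinear_map K B B B h"
  shows tensor_prod_bilinear: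
      "bilinear_map K (tensor K A B) (tensor K A B) (tensor K A B) (tensor_prod K A B g h)"
    and tensor_prod_pure:
      "\<lbrakk>a \<in> carrier A; b \<in> carrier B; a' \<in> carrier A; b' \<in> carrier B\<rbrakk> \<Longrightarrow>
        tensor_prod K A B g h (pure_tensor K A B a b) (pure_tensor K A B a' b') =
        pure_tensor K A B (g a a') (h b b')"
proof -
  let ?T = "tensor K A B"
  let ?F = "\<lambda>Y x1 x2. tensor_lift ?T (\<lambda>y1 y2. pure_tensor K A B (g x1 y1) (h x2 y2)) Y"
  note T = module_tensor[OF A B]
  note pure = bilinear_pure_tensor[OF A B]
  have b1: "bilinear_map K A B ?T (\<lambda>y1 y2. pure_tensor K A B (g x1 y1) (h x2 y2))"
    if "x1 \<in> carrier A" "x2 \<in> carrier B" for x1 x2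
    by (rule bilinear_map_comp[OF pure bilinear_mapD(1)[OF g that(1)] bilinear_mapD(1)[OF h that(2)]])
  have b2: "bilinear_map K A B ?T (?F Y)" if Y: "Y \<in> carrier ?T" for Y
  proof (rule bilinear_mapI)
    show "linear_map K B ?T (?F Y a)" if "a \<in> carrier A" for a
      by (rule linear_map_tensor_lift[OF A B T b1 linear_map_bilinear_right[OF pure] B Y])
        (use that in \<open>simp_all add: bilinear_mapD[OF g] bilinear_mapD[OF h]\<close>)
    show "linear_map K A ?T (\<lambda>a. ?F Y a b)" if "b \<in> carrier B" for b
      by (rule linear_map_tensor_lift[OF A B T b1 linear_map_bilinear_left[OF pure] A Y])
        (use that in \<open>simp_all add: bilinear_mapD[OF g] bilinear_mapD[OF h]\<close>)
  qed
  have eq: "tensor_prod K A B g h = (\<lambda>X Y. tensor_lift ?T (?F Y) X)"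
    by (simp add: tensor_prod_def fun_eq_iff)
  show "bilinear_map K ?T ?T ?T (tensor_prod K A B g h)"
    unfolding eq
  proof (rule bilinear_mapI)
    show "linear_map K ?T ?T (\<lambda>Y. tensor_lift ?T (?F Y) X)" if "X \<in> carrier ?T" for X
      by (rule linear_map_tensor_lift[OF A B T b2 tensor_universal(1)[OF A B T b1] T that])
    show "linear_map K ?T ?T (\<lambda>X. tensor_lift ?T (?F Y) X)" if "Y \<in> carrier ?T" for Y
      by (rule tensor_universal(1)[OF A B T b2[OF that]])
  qed
  show "tensor_prod K A B g h (pure_tensor K A B a b) (pure_tensor K A B a' b') =
        pure_tensor K A B (g a a') (h b b')"
    if "a \<in> carrier A" "b \<in> carrier B" "a' \<in> carrier A" "b' \<in> carrier B"
    using that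
    by (simp add: eq tensor_universal(2)[OF A B T b2] tensor_universal(2)[OF A B T b1]
        pure_tensor_closed)
qed

text \<open>Both sides are trilinear, so pure tensors suffice, and there the claim splits into one
  identity per factor. Four products per factor are left free because the dendriform axioms mix
  different products inside and outside the brackets.\<close>

lemma tensor_prod_assoc:
  assumes A: "module K A" and B: "module K B"
    and g: "bilinear_map K A A A g1" "bilinear_map K A A A g2"
      "bilinear_map K A A A g3" "bilinear_map K A A A g4"
    and h: "bilinear_map K B B B h1" "bilinear_map K B B B h2"
      "bilinear_map K B B B h3" "bilinear_map K B B B h4"
    and gg: "\<And>x y z. \<lbrakk>x \<in> carrier A; y \<in> carrier A; z \<in> carrier A\<rbrakk> \<Longrightarrow>
      g1 (g2 x y) z = g3 x (g4 y z)"
    and hh: "\<And>x y z. \<lbrakk>x \<in> carrier B; y \<in> carrier B; z \<in> carrier B\<rbrakk> \<Longrightarrow>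
      h1 (h2 x y) z = h3 x (h4 y z)"
    and XYZ: "X \<in> carrier (tensor K A B)" "Y \<in> carrier (tensor K A B)"
      "Z \<in> carrier (tensor K A B)"
  shows "tensor_prod K A B g1 h1 (tensor_prod K A B g2 h2 X Y) Z =
    tensor_prod K A B g3 h3 X (tensor_prod K A B g4 h4 Y Z)"
proof -
  let ?T = "tensor K A B"
  note T = module_tensor[OF A B]
  note P1 = tensor_prod[OF A B g(1) h(1)] and P2 = tensor_prod[OF A B g(2) h(2)]
    and P3 = tensor_prod[OF A B g(3) h(3)] and P4 = tensor_prod[OF A B g(4) h(4)]
  note c = bilinear_mapD(3)
  have eq: "tensor_prod K A B g1 h1 (tensor_prod K A B g2 h2 (pure_tensor K A B a b) Y) Z =
    tensor_prod K A B g3 h3 (pure_tensor K A B a b) (tensor_prod K A B g4 h4 Y Z)"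
    if ab: "a \<in> carrier A" "b \<in> carrier B" for a b
  proof (rule tensor_bilinear_ext[OF A B A B T _ _ _ XYZ(2,3)])
    note x = pure_tensor_closed[OF ab, of K]
    show "bilinear_map K ?T ?T ?T
        (\<lambda>Y. tensor_prod K A B g1 h1 (tensor_prod K A B g2 h2 (pure_tensor K A B a b) Y))"
      by (rule bilinear_map_comp[OF P1(1) bilinear_mapD(1)[OF P2(1) x] linear_map_id])
    show "bilinear_map K ?T ?T ?T
        (\<lambda>Y Z. tensor_prod K A B g3 h3 (pure_tensor K A B a b) (tensor_prod K A B g4 h4 Y Z))"
      by (rule bilinear_map_comp_linear[OF bilinear_mapD(1)[OF P3(1) x] P4(1)])
  qed (use ab in \<open>simp add: P1(2) P2(2) P3(2) P4(2) pure_tensor_closed gg hh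
      c[OF g(2)] c[OF g(4)] c[OF h(2)] c[OF h(4)]\<close>)
  have L: "linear_map K ?T ?T (\<lambda>X. tensor_prod K A B g1 h1 (tensor_prod K A B g2 h2 X Y) Z)"
    by (rule linear_map_bilinear_left[OF P1(1) bilinear_mapD(2)[OF P2(1) XYZ(2)] XYZ(3)])
  have R: "linear_map K ?T ?T (\<lambda>X. tensor_prod K A B g3 h3 X (tensor_prod K A B g4 h4 Y Z))"
    by (rule bilinear_mapD(2)[OF P3(1) bilinear_mapD(3)[OF P4(1) XYZ(2,3)]])
  show ?thesis
    by (rule tensor_ext[OF A B T L R eq XYZ(1)])
qed

section \<open>Unital dendriform algebras with totally defined products\<close>

text \<open>The operations are kept apart from the underlying module, so that a module already
  constructed, such as a tensor product, can be equipped with them.\<close>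

record ('k, 'a) dend_ops =
  lprod :: "'a \<Rightarrow> 'a \<Rightarrow> 'a"
  rprod :: "'a \<Rightarrow> 'a \<Rightarrow> 'a"
  unit :: 'a
  counit :: "'a \<Rightarrow> 'k"

definition full_prod ::
  "('k, 'm) ring_scheme \<Rightarrow> ('k, 'a, 'p) module_scheme \<Rightarrow> ('k, 'a) dend_ops \<Rightarrow> 'a \<Rightarrow> 'a \<Rightarrow> 'a"
  where "full_prod K W S x y = lprod S x y \<oplus>\<^bsub>W\<^esub> rprod S x y \<oplus>\<^bsub>W\<^esub>
    (counit S x \<otimes>\<^bsub>K\<^esub> counit S y) \<odot>\<^bsub>W\<^esub> unit S"

text \<open>Since \<open>1 \<prec> 1 = 1 \<succ> 1 = 0\<close>, the laws
  \<open>x \<prec> 1 = x\<close> and \<open>1 \<succ> x = x\<close> acquire a counit term. In return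
  all laws hold without case distinctions and are multilinear, hence can be tested on pure
  tensors.\<close>

locale total_dendriform = module K W
  for K (structure) and W :: "('k, 'a, 'p) module_scheme" (structure) +
  fixes S :: "('k, 'a) dend_ops"
  assumes lprod_bilinear: "bilinear_map K W W W (lprod S)"
    and rprod_bilinear: "bilinear_map K W W W (rprod S)"
    and unit_in: "unit S \<in> carrier W"
    and counit_linear: "linear_map K W (regular_module K) (counit S)"
    and counit_unit: "counit S (unit S) = \<one>\<^bsub>K\<^esub>"
    and counit_lprod: "\<lbrakk>x \<in> carrier W; y \<in> carrier W\<rbrakk> \<Longrightarrow> counit S (lprod S x y) = \<zero>\<^bsub>K\<^esub>"
    and counit_rprod: "\<lbrakk>x \<in> carrier W; y \<in> carrier W\<rbrakk> \<Longrightarrow> counit S (rprod S x y) = \<zero>\<^bsub>K\<^esub>"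
    and unit_lprod: "x \<in> carrier W \<Longrightarrow> lprod S (unit S) x = \<zero>\<^bsub>W\<^esub>"
    and rprod_unit: "x \<in> carrier W \<Longrightarrow> rprod S x (unit S) = \<zero>\<^bsub>W\<^esub>"
    and lprod_unit: "x \<in> carrier W \<Longrightarrow>
      lprod S x (unit S) \<oplus>\<^bsub>W\<^esub> counit S x \<odot>\<^bsub>W\<^esub> unit S = x"
    and unit_rprod: "x \<in> carrier W \<Longrightarrow>
      rprod S (unit S) x \<oplus>\<^bsub>W\<^esub> counit S x \<odot>\<^bsub>W\<^esub> unit S = x"
    and lprod_lprod: "\<lbrakk>x \<in> carrier W; y \<in> carrier W; z \<in> carrier W\<rbrakk> \<Longrightarrow>
      lprod S (lprod S x y) z = lprod S x (full_prod K W S y z)"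
    and rprod_lprod: "\<lbrakk>x \<in> carrier W; y \<in> carrier W; z \<in> carrier W\<rbrakk> \<Longrightarrow>
      lprod S (rprod S x y) z = rprod S x (lprod S y z)"
    and full_rprod: "\<lbrakk>x \<in> carrier W; y \<in> carrier W; z \<in> carrier W\<rbrakk> \<Longrightarrow>
      rprod S (full_prod K W S x y) z = rprod S x (rprod S y z)"
begin

lemma module_W: "module K W"
  by (rule module_axioms)

lemmas lprod_closed [simp] = bilinear_mapD(3)[OF lprod_bilinear]
  and rprod_closed [simp] = bilinear_mapD(3)[OF rprod_bilinear]
lemmas counit_closed [simp] = linear_mapD(1)[OF counit_linear, simplified]
  and counit_add = linear_mapD(2)[OF counit_linear, simplified]
  and counit_smult = linear_mapD(3)[OF counit_linear, simplified]
lemmas lprod_add = linear_mapD(2)[OF bilinear_mapD(2)[OF lprod_bilinear]]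
    linear_mapD(2)[OF bilinear_mapD(1)[OF lprod_bilinear]]
  and rprod_add = linear_mapD(2)[OF bilinear_mapD(2)[OF rprod_bilinear]]
    linear_mapD(2)[OF bilinear_mapD(1)[OF rprod_bilinear]]
  and lprod_smult = linear_mapD(3)[OF bilinear_mapD(2)[OF lprod_bilinear]]
    linear_mapD(3)[OF bilinear_mapD(1)[OF lprod_bilinear]]
  and rprod_smult = linear_mapD(3)[OF bilinear_mapD(2)[OF rprod_bilinear]]
    linear_mapD(3)[OF bilinear_mapD(1)[OF rprod_bilinear]]

declare unit_in [simp] counit_unit [simp] counit_lprod [simp] counit_rprod [simp]
  unit_lprod [simp] rprod_unit [simp]

lemma smult_unit_bilinear:
  "bilinear_map K W W W (\<lambda>x y. (counit S x \<otimes>\<^bsub>K\<^esub> counit S y) \<odot>\<^bsub>W\<^esub> unit S)"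
  by (rule bilinear_map_comp_linear[OF bilinear_mapD(2)[OF bilinear_map_smult[OF module_W] unit_in]])
    (rule bilinear_map_comp[OF _ counit_linear counit_linear],
      use bilinear_map_smult[OF module_regular_module[OF is_cring]] in \<open>simp add: regular_module_def\<close>)

lemma full_prod_bilinear: "bilinear_map K W W W (full_prod K W S)"
  unfolding full_prod_def[abs_def]
  by (intro bilinear_map_add module_W lprod_bilinear rprod_bilinear smult_unit_bilinear)

lemmas full_prod_closed [simp] = bilinear_mapD(3)[OF full_prod_bilinear]
  and full_prod_add = linear_mapD(2)[OF bilinear_mapD(2)[OF full_prod_bilinear]]
    linear_mapD(2)[OF bilinear_mapD(1)[OF full_prod_bilinear]]
  and full_prod_smult = linear_mapD(3)[OF bilinear_mapD(2)[OF full_prod_bilinear]]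
    linear_mapD(3)[OF bilinear_mapD(1)[OF full_prod_bilinear]]

lemma counit_full_prod [simp]:
  "\<lbrakk>x \<in> carrier W; y \<in> carrier W\<rbrakk> \<Longrightarrow>
    counit S (full_prod K W S x y) = counit S x \<otimes>\<^bsub>K\<^esub> counit S y"
  by (simp add: full_prod_def counit_add counit_smult)

lemma full_prod_unit [simp]:
  "x \<in> carrier W \<Longrightarrow> full_prod K W S x (unit S) = x"
  "x \<in> carrier W \<Longrightarrow> full_prod K W S (unit S) x = x"
  by (simp_all add: full_prod_def lprod_unit unit_rprod)

text \<open>Associativity is the sum of the three product laws. The unit summand of the inner
  product disappears, because \<open>1 \<prec> z = 0\<close> on the left side and
  \<open>x \<succ> 1 = 0\<close> on the right side.\<close>

lemma full_prod_assoc: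
  assumes x: "x \<in> carrier W" and y: "y \<in> carrier W" and z: "z \<in> carrier W"
  shows "full_prod K W S (full_prod K W S x y) z = full_prod K W S x (full_prod K W S y z)"
proof -
  have "full_prod K W S (full_prod K W S x y) z =
      lprod S (full_prod K W S x y) z \<oplus>\<^bsub>W\<^esub> rprod S (full_prod K W S x y) z \<oplus>\<^bsub>W\<^esub>
      (counit S x \<otimes>\<^bsub>K\<^esub> counit S y \<otimes>\<^bsub>K\<^esub> counit S z) \<odot>\<^bsub>W\<^esub> unit S"
    using assms by (simp add: full_prod_def[of K W S "full_prod K W S x y" z])
  also have "lprod S (full_prod K W S x y) z =
      lprod S x (full_prod K W S y z) \<oplus>\<^bsub>W\<^esub> rprod S x (lprod S y z)"
    using assms
    by (simp add: full_prod_def[of K W S x y] lprod_add lprod_smult lprod_lprod rprod_lprod)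
  also have "rprod S (full_prod K W S x y) z = rprod S x (rprod S y z)"
    using assms by (rule full_rprod)
  also have "lprod S x (full_prod K W S y z) \<oplus>\<^bsub>W\<^esub> rprod S x (lprod S y z) \<oplus>\<^bsub>W\<^esub>
      rprod S x (rprod S y z) \<oplus>\<^bsub>W\<^esub>
      (counit S x \<otimes>\<^bsub>K\<^esub> counit S y \<otimes>\<^bsub>K\<^esub> counit S z) \<odot>\<^bsub>W\<^esub> unit S =
      lprod S x (full_prod K W S y z) \<oplus>\<^bsub>W\<^esub> rprod S x (full_prod K W S y z) \<oplus>\<^bsub>W\<^esub>
      (counit S x \<otimes>\<^bsub>K\<^esub> (counit S y \<otimes>\<^bsub>K\<^esub> counit S z)) \<odot>\<^bsub>W\<^esub> unit S"
    using assms
    by (simp add: full_prod_def[of K W S y z] rprod_add rprod_smult M.a_assoc R.m_assoc)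
  also have "\<dots> = full_prod K W S x (full_prod K W S y z)"
    using assms by (simp add: full_prod_def[of K W S x "full_prod K W S y z"])
  finally show ?thesis .
qed

end

section \<open>Morphisms of totally defined unital dendriform algebras\<close>

definition dend_ops_hom ::
  "('k, 'm) ring_scheme \<Rightarrow> ('k, 'a, 'p) module_scheme \<Rightarrow> ('k, 'a) dend_ops \<Rightarrow>
   ('k, 'b, 'q) module_scheme \<Rightarrow> ('k, 'b) dend_ops \<Rightarrow> ('a \<Rightarrow> 'b) \<Rightarrow> bool"
  where "dend_ops_hom K A R B S f \<longleftrightarrow> linear_map K A B f \<and>
    (\<forall>x\<in>carrier A. \<forall>y\<in>carrier A. f (lprod R x y) = lprod S (f x) (f y) \<and>
      f (rprod R x y) = rprod S (f x) (f y)) \<and>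
    f (unit R) = unit S \<and> (\<forall>x\<in>carrier A. counit S (f x) = counit R x)"

lemma dend_ops_homD:
  assumes "dend_ops_hom K A R B S f"
  shows "linear_map K A B f"
    and "\<lbrakk>x \<in> carrier A; y \<in> carrier A\<rbrakk> \<Longrightarrow> f (lprod R x y) = lprod S (f x) (f y)"
    and "\<lbrakk>x \<in> carrier A; y \<in> carrier A\<rbrakk> \<Longrightarrow> f (rprod R x y) = rprod S (f x) (f y)"
    and "f (unit R) = unit S"
    and "x \<in> carrier A \<Longrightarrow> counit S (f x) = counit R x"
  using assms by (auto simp: dend_ops_hom_def)

lemma dend_ops_hom_comp:
  assumes "dend_ops_hom K A R B S f" "dend_ops_hom K B S C T g"
  shows "dend_ops_hom K A R C T (\<lambda>x. g (f x))"
  unfolding dend_ops_hom_def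
  using linear_map_comp[OF dend_ops_homD(1)[OF assms(2)] dend_ops_homD(1)[OF assms(1)]]
  by (simp add: dend_ops_homD[OF assms(1)] dend_ops_homD[OF assms(2)]
      linear_mapD(1)[OF dend_ops_homD(1)[OF assms(1)]])

lemma dend_ops_hom_id: "dend_ops_hom K A R A R (\<lambda>x. x)"
  by (simp add: dend_ops_hom_def linear_map_id)

lemma dend_ops_hom_full_prod:
  assumes A: "total_dendriform K A R" and B: "total_dendriform K B S"
    and f: "dend_ops_hom K A R B S f" and x: "x \<in> carrier A" and y: "y \<in> carrier A"
  shows "f (full_prod K A R x y) = full_prod K B S (f x) (f y)"
proof -
  interpret A: total_dendriform K A R by fact
  interpret B: total_dendriform K B S by fact
  note lin = linear_mapD[OF dend_ops_homD(1)[OF f]]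
  show ?thesis using x y
    by (simp add: full_prod_def lin dend_ops_homD[OF f])
qed

section \<open>Tensor products of unital dendriform algebras\<close>

text \<open>This is \<open>id \<otimes> \<epsilon>\<close>, and \<open>left_counit\<close> is
  \<open>\<epsilon> \<otimes> id\<close>; the counit axioms say that both are inverse to the
  coproduct from the left.\<close>

definition right_counit ::
  "('k, 'a, 'p) module_scheme \<Rightarrow> ('k, 'b) dend_ops \<Rightarrow> ('k, 'a, 'b) tterm set \<Rightarrow> 'a"
  where "right_counit A S = tensor_lift A (\<lambda>a b. counit S b \<odot>\<^bsub>A\<^esub> a)"

definition left_counit ::
  "('k, 'a) dend_ops \<Rightarrow> ('k, 'b, 'q) module_scheme \<Rightarrow> ('k, 'a, 'b) tterm set \<Rightarrow> 'b"
  where "left_counit R B = tensor_lift B (\<lambda>a b. counit R a \<odot>\<^bsub>B\<^esub> b)"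

text \<open>The products act on the second factor, with the full product on the first. Where both
  second components are \<open>1\<close>, the products of \<open>S\<close> vanish, and the added
  summand multiplies the first components instead. Expressing it through \<open>right_counit\<close>
  keeps the formula bilinear and independent of a presentation of \<open>X\<close> and
  \<open>Y\<close>.\<close>

definition tensor_ops ::
  "('k, 'm) ring_scheme \<Rightarrow> ('k, 'a, 'p) module_scheme \<Rightarrow> ('k, 'a) dend_ops \<Rightarrow>
   ('k, 'b, 'q) module_scheme \<Rightarrow> ('k, 'b) dend_ops \<Rightarrow> ('k, ('k, 'a, 'b) tterm set) dend_ops"
  where "tensor_ops K A R B S =
    \<lparr>lprod = (\<lambda>X Y. tensor_prod K A B (full_prod K A R) (lprod S) X Y \<oplus>\<^bsub>tensor K A B\<^esub>
       pure_tensor K A B (lprod R (right_counit A S X) (right_counit A S Y)) (unit S)),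
     rprod = (\<lambda>X Y. tensor_prod K A B (full_prod K A R) (rprod S) X Y \<oplus>\<^bsub>tensor K A B\<^esub>
       pure_tensor K A B (rprod R (right_counit A S X) (right_counit A S Y)) (unit S)),
     unit = pure_tensor K A B (unit R) (unit S),
     counit = (\<lambda>X. counit R (right_counit A S X))\<rparr>"

locale total_dendriform_pair = A: total_dendriform K A R + B: total_dendriform K B S
  for K :: "('k, 'm) ring_scheme" and A :: "('k, 'a, 'p) module_scheme" and R
    and B :: "('k, 'b, 'q) module_scheme" and S
begin

abbreviation "T \<equiv> tensor K A B"
abbreviation "tp \<equiv> tensor_prod K A B"
abbreviation "TO \<equiv> tensor_ops K A R B S"
abbreviation "rc \<equiv> right_counit A S"
abbreviation "lc \<equiv> left_counit R B"
abbreviation "pt \<equiv> pure_tensor K A B"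
abbreviation "sA \<equiv> full_prod K A R"
abbreviation "sB \<equiv> full_prod K B S"

sublocale T: module K T
  by (rule module_tensor[OF A.module_W B.module_W])

lemmas mods = A.module_W B.module_W
lemmas T_module = T.module_axioms
lemmas pt_closed [simp] = pure_tensor_closed[of _ A _ B K]
lemmas pt_linear = pure_tensor_linear[OF mods]
lemmas pt_add = linear_mapD(2)[OF pt_linear(1)] linear_mapD(2)[OF pt_linear(2)]
lemmas pt_smult = linear_mapD(3)[OF pt_linear(1)] linear_mapD(3)[OF pt_linear(2)]
lemmas pt_zero [simp] = pure_tensor_zero[OF mods]
lemmas T_ext = tensor_ext[OF mods] and T_bilinear_ext = tensor_bilinear_ext[OF mods mods]
lemmas fl = tensor_prod[OF mods A.full_prod_bilinear B.lprod_bilinear]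
  and fr = tensor_prod[OF mods A.full_prod_bilinear B.rprod_bilinear]
  and ff = tensor_prod[OF mods A.full_prod_bilinear B.full_prod_bilinear]
lemmas tp_closed [simp] = bilinear_mapD(3)[OF fl(1)] bilinear_mapD(3)[OF fr(1)]
    bilinear_mapD(3)[OF ff(1)]
lemmas tp_pure [simp] = fl(2) fr(2) ff(2)

lemma rc_bilinear: "bilinear_map K A B A (\<lambda>a b. counit S b \<odot>\<^bsub>A\<^esub> a)"
  using bilinear_map_comp[OF bilinear_map_smult[OF mods(1)] B.counit_linear linear_map_id]
  by (simp add: bilinear_map_def)

lemma lc_bilinear: "bilinear_map K A B B (\<lambda>a b. counit R a \<odot>\<^bsub>B\<^esub> b)"
  by (rule bilinear_map_comp[OF bilinear_map_smult[OF mods(2)] A.counit_linear linear_map_id])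

lemma rc_linear: "linear_map K T A rc"
  unfolding right_counit_def by (rule tensor_universal(1)[OF mods mods(1) rc_bilinear])

lemma lc_linear: "linear_map K T B lc"
  unfolding left_counit_def by (rule tensor_universal(1)[OF mods mods(2) lc_bilinear])

lemma rc_pure [simp]: "\<lbrakk>a \<in> carrier A; b \<in> carrier B\<rbrakk> \<Longrightarrow> rc (pt a b) = counit S b \<odot>\<^bsub>A\<^esub> a"
  unfolding right_counit_def by (rule tensor_universal(2)[OF mods mods(1) rc_bilinear])

lemma lc_pure [simp]: "\<lbrakk>a \<in> carrier A; b \<in> carrier B\<rbrakk> \<Longrightarrow> lc (pt a b) = counit R a \<odot>\<^bsub>B\<^esub> b"
  unfolding left_counit_def by (rule tensor_universal(2)[OF mods mods(2) lc_bilinear])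

lemmas rc_closed [simp] = linear_mapD(1)[OF rc_linear]
  and lc_closed [simp] = linear_mapD(1)[OF lc_linear]
lemmas rc_add = linear_mapD(2)[OF rc_linear] and lc_add = linear_mapD(2)[OF lc_linear]

text \<open>Both sides are \<open>\<epsilon> \<otimes> \<epsilon>\<close>.\<close>

lemma counit_lc:
  assumes "X \<in> carrier T"
  shows "counit S (lc X) = counit R (rc X)"
proof (rule T_ext[OF module_regular_module[OF A.is_cring] _ _ _ assms])
  show "linear_map K T (regular_module K) (\<lambda>X. counit S (lc X))"
    by (rule linear_map_comp[OF B.counit_linear lc_linear])
  show "linear_map K T (regular_module K) (\<lambda>X. counit R (rc X))"
    by (rule linear_map_comp[OF A.counit_linear rc_linear])
qed (simp add: A.counit_smult B.counit_smult A.R.m_comm)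

text \<open>On pure tensors \<open>id \<otimes> \<epsilon>\<close> only sees the counit of the
  second component, which vanishes on \<open>\<prec>\<close> and \<open>\<succ>\<close> and is
  multiplicative for the full product.\<close>

lemma rc_tp:
  assumes XY: "X \<in> carrier T" "Y \<in> carrier T"
  shows "rc (tp sA (lprod S) X Y) = \<zero>\<^bsub>A\<^esub>" and "rc (tp sA (rprod S) X Y) = \<zero>\<^bsub>A\<^esub>"
    and "rc (tp sA sB X Y) = sA (rc X) (rc Y)"
proof -
  have zero: "bilinear_map K T T A (\<lambda>_ _. \<zero>\<^bsub>A\<^esub>)"
    by (simp add: bilinear_map_def linear_map_def)
  note bil = bilinear_map_comp_linear[OF rc_linear]
  show "rc (tp sA (lprod S) X Y) = \<zero>\<^bsub>A\<^esub>"
    by (rule T_bilinear_ext[OF mods(1) bil[OF fl(1)] zero _ XY]) simp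
  show "rc (tp sA (rprod S) X Y) = \<zero>\<^bsub>A\<^esub>"
    by (rule T_bilinear_ext[OF mods(1) bil[OF fr(1)] zero _ XY]) simp
  show "rc (tp sA sB X Y) = sA (rc X) (rc Y)"
    by (rule T_bilinear_ext[OF mods(1) bil[OF ff(1)]
          bilinear_map_comp[OF A.full_prod_bilinear rc_linear rc_linear] _ XY])
      (simp add: A.full_prod_smult A.smult_assoc1[symmetric] A.R.m_comm)
qed

lemma lc_tp:
  assumes XY: "X \<in> carrier T" "Y \<in> carrier T"
  shows "lc (tp sA (lprod S) X Y) = lprod S (lc X) (lc Y)"
    and "lc (tp sA (rprod S) X Y) = rprod S (lc X) (lc Y)"
proof -
  note bil = bilinear_map_comp_linear[OF lc_linear]
  show "lc (tp sA (lprod S) X Y) = lprod S (lc X) (lc Y)"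
    by (rule T_bilinear_ext[OF mods(2) bil[OF fl(1)]
          bilinear_map_comp[OF B.lprod_bilinear lc_linear lc_linear] _ XY])
      (simp add: B.lprod_smult B.smult_assoc1[symmetric] A.R.m_comm)
  show "lc (tp sA (rprod S) X Y) = rprod S (lc X) (lc Y)"
    by (rule T_bilinear_ext[OF mods(2) bil[OF fr(1)]
          bilinear_map_comp[OF B.rprod_bilinear lc_linear lc_linear] _ XY])
      (simp add: B.rprod_smult B.smult_assoc1[symmetric] A.R.m_comm)
qed

lemma ops_simps:
  "lprod TO X Y = tp sA (lprod S) X Y \<oplus>\<^bsub>T\<^esub> pt (lprod R (rc X) (rc Y)) (unit S)"
  "rprod TO X Y = tp sA (rprod S) X Y \<oplus>\<^bsub>T\<^esub> pt (rprod R (rc X) (rc Y)) (unit S)"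
  "unit TO = pt (unit R) (unit S)"
  "counit TO X = counit R (rc X)"
  by (simp_all add: tensor_ops_def)

lemma pt_comp_bilinear:
  assumes "bilinear_map K A A A g"
  shows "bilinear_map K T T T (\<lambda>X Y. pt (g (rc X) (rc Y)) (unit S))"
  by (rule bilinear_map_comp_linear[OF pt_linear(1)[OF B.unit_in]
        bilinear_map_comp[OF assms rc_linear rc_linear]])

lemma ops_bilinear:
  "bilinear_map K T T T (lprod TO)" "bilinear_map K T T T (rprod TO)"
  using bilinear_map_add[OF T_module fl(1) pt_comp_bilinear[OF A.lprod_bilinear]]
    bilinear_map_add[OF T_module fr(1) pt_comp_bilinear[OF A.rprod_bilinear]]
  by (simp_all add: tensor_ops_def)

lemmas tp_add = linear_mapD(2)[OF bilinear_mapD(1)[OF fl(1)]] linear_mapD(2)[OF bilinear_mapD(2)[OF fl(1)]]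
  linear_mapD(2)[OF bilinear_mapD(1)[OF fr(1)]] linear_mapD(2)[OF bilinear_mapD(2)[OF fr(1)]]
  linear_mapD(2)[OF bilinear_mapD(1)[OF ff(1)]] linear_mapD(2)[OF bilinear_mapD(2)[OF ff(1)]]

lemma rc_ops:
  assumes "X \<in> carrier T" "Y \<in> carrier T"
  shows "rc (lprod TO X Y) = lprod R (rc X) (rc Y)"
    and "rc (rprod TO X Y) = rprod R (rc X) (rc Y)"
  using assms by (simp_all add: ops_simps rc_add rc_tp)

lemma lc_ops:
  assumes "X \<in> carrier T" "Y \<in> carrier T"
  shows "lc (lprod TO X Y) = lprod S (lc X) (lc Y)"
    and "lc (rprod TO X Y) = rprod S (lc X) (lc Y)"
  using assms by (simp_all add: ops_simps lc_add lc_tp)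

text \<open>Because \<open>1 \<prec> b = 0\<close> and \<open>b \<succ> 1 = 0\<close> in the second
  factor, the correction terms of \<open>tensor_ops\<close> contribute no cross terms to iterated
  products.\<close>

lemma tp_pt_unit:
  assumes "X \<in> carrier T" "a \<in> carrier A"
  shows "tp sA (lprod S) (pt a (unit S)) X = \<zero>\<^bsub>T\<^esub>"
    and "tp sA (rprod S) X (pt a (unit S)) = \<zero>\<^bsub>T\<^esub>"
proof -
  have zero: "linear_map K T T (\<lambda>_. \<zero>\<^bsub>T\<^esub>)"
    by (simp add: linear_map_def)
  have c: "pt a (unit S) \<in> carrier T" using assms by simp
  show "tp sA (lprod S) (pt a (unit S)) X = \<zero>\<^bsub>T\<^esub>"
    by (rule T_ext[OF T_module bilinear_mapD(1)[OF fl(1) c] zero _ assms(1)]) (use assms in simp)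
  show "tp sA (rprod S) X (pt a (unit S)) = \<zero>\<^bsub>T\<^esub>"
    by (rule T_ext[OF T_module bilinear_mapD(2)[OF fr(1) c] zero _ assms(1)]) (use assms in simp)
qed

text \<open>The full product of the second components is split into its three summands. Its unit
  summand leaves \<open>sA (rc X) (rc Y)\<close> in the first factor, and splitting this again
  yields the two correction terms and the unit term of the tensor product. Hence the associative
  product is componentwise, as \<open>tensor_prod_assoc\<close> requires.\<close>

lemma full_prod_tensor:
  assumes XY: "X \<in> carrier T" "Y \<in> carrier T"
  shows "full_prod K T TO X Y = tp sA sB X Y"
proof -
  have "tp sA sB X Y = tp sA (lprod S) X Y \<oplus>\<^bsub>T\<^esub> tp sA (rprod S) X Y \<oplus>\<^bsub>T\<^esub> pt (sA (rc X) (rc Y)) (unit S)"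
  proof (rule T_bilinear_ext[OF T_module ff(1) _ _ XY])
    show "bilinear_map K T T T
        (\<lambda>X Y. tp sA (lprod S) X Y \<oplus>\<^bsub>T\<^esub> tp sA (rprod S) X Y \<oplus>\<^bsub>T\<^esub> pt (sA (rc X) (rc Y)) (unit S))"
      by (intro bilinear_map_add T_module fl(1) fr(1) pt_comp_bilinear A.full_prod_bilinear)
  qed (simp add: full_prod_def[of K B] pt_add pt_smult A.full_prod_smult
      A.smult_assoc1[symmetric] T.smult_assoc1[symmetric] A.R.m_comm)
  also have "\<dots> = full_prod K T TO X Y"
    using XY by (simp add: full_prod_def[of K A] full_prod_def[of K T] ops_simps pt_add pt_smult T.M.a_ac)
  finally show ?thesis ..
qed

lemma pt_swap:
  "\<lbrakk>c \<in> carrier K; a \<in> carrier A; b \<in> carrier B\<rbrakk> \<Longrightarrow> pt (c \<odot>\<^bsub>A\<^esub> a) b = pt a (c \<odot>\<^bsub>B\<^esub> b)"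
  by (simp add: pt_smult)

text \<open>On \<open>a \<otimes> b\<close> the scalar \<open>\<epsilon>(b)\<close> moves into the
  second factor, and the unit law of \<open>B\<close> collects the two terms into
  \<open>a \<otimes> b\<close>.\<close>

lemma tp_unit:
  assumes X: "X \<in> carrier T"
  shows "tp sA (lprod S) X (pt (unit R) (unit S)) \<oplus>\<^bsub>T\<^esub> pt (rc X) (unit S) = X"
    and "tp sA (rprod S) (pt (unit R) (unit S)) X \<oplus>\<^bsub>T\<^esub> pt (rc X) (unit S) = X"
proof -
  have u: "pt (unit R) (unit S) \<in> carrier T" by simp
  note rcl = linear_map_comp[OF pt_linear(1)[OF B.unit_in] rc_linear]
  show "tp sA (lprod S) X (pt (unit R) (unit S)) \<oplus>\<^bsub>T\<^esub> pt (rc X) (unit S) = X"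
    by (rule T_ext[OF T_module
          linear_map_add[OF T_module bilinear_mapD(2)[OF fl(1) u] rcl] linear_map_id _ X])
      (simp add: pt_swap pt_add(2)[symmetric] B.lprod_unit)
  show "tp sA (rprod S) (pt (unit R) (unit S)) X \<oplus>\<^bsub>T\<^esub> pt (rc X) (unit S) = X"
    by (rule T_ext[OF T_module
          linear_map_add[OF T_module bilinear_mapD(1)[OF fr(1) u] rcl] linear_map_id _ X])
      (simp add: pt_swap pt_add(2)[symmetric] B.unit_rprod)
qed

lemma total_dendriform_tensor: "total_dendriform K T TO"
proof (intro total_dendriform.intro total_dendriform_axioms.intro T_module ops_bilinear)
  show "unit TO \<in> carrier T" by (simp add: ops_simps)
  show "linear_map K T (regular_module K) (counit TO)"
    using linear_map_comp[OF A.counit_linear rc_linear] by (simp add: tensor_ops_def)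
  show "counit TO (unit TO) = \<one>\<^bsub>K\<^esub>" by (simp add: ops_simps)
  fix X assume X: "X \<in> carrier T"
  show "lprod TO (unit TO) X = \<zero>\<^bsub>T\<^esub>" "rprod TO X (unit TO) = \<zero>\<^bsub>T\<^esub>"
    using X by (simp_all add: ops_simps tp_pt_unit)
  have r: "rc X = lprod R (rc X) (unit R) \<oplus>\<^bsub>A\<^esub> counit R (rc X) \<odot>\<^bsub>A\<^esub> unit R"
    "rc X = rprod R (unit R) (rc X) \<oplus>\<^bsub>A\<^esub> counit R (rc X) \<odot>\<^bsub>A\<^esub> unit R"
    using X by (simp_all add: A.lprod_unit A.unit_rprod)
  \<comment> \<open>The unit law of \<open>A\<close> splits the second term of
    \<open>tp_unit\<close> into the correction term of \<open>tensor_ops\<close> and the counit term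
    required by the unit law of \<open>T\<close>.\<close>
  have pr: "pt (rc X) (unit S) = pt (lprod R (rc X) (unit R)) (unit S) \<oplus>\<^bsub>T\<^esub> counit R (rc X) \<odot>\<^bsub>T\<^esub> pt (unit R) (unit S)"
    "pt (rc X) (unit S) = pt (rprod R (unit R) (rc X)) (unit S) \<oplus>\<^bsub>T\<^esub> counit R (rc X) \<odot>\<^bsub>T\<^esub> pt (unit R) (unit S)"
    using X by (subst r(1), simp add: pt_add pt_smult) (use X in \<open>subst r(2), simp add: pt_add pt_smult\<close>)
  show "lprod TO X (unit TO) \<oplus>\<^bsub>T\<^esub> counit TO X \<odot>\<^bsub>T\<^esub> unit TO = X"
    using X tp_unit(1)[OF X] unfolding pr(1) by (simp add: ops_simps T.M.a_assoc)
  show "rprod TO (unit TO) X \<oplus>\<^bsub>T\<^esub> counit TO X \<odot>\<^bsub>T\<^esub> unit TO = X"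
    using X tp_unit(2)[OF X] unfolding pr(2) by (simp add: ops_simps T.M.a_assoc)
  fix Y assume Y: "Y \<in> carrier T"
  show "counit TO (lprod TO X Y) = \<zero>\<^bsub>K\<^esub>" "counit TO (rprod TO X Y) = \<zero>\<^bsub>K\<^esub>"
    using X Y by (simp_all add: ops_simps(4) rc_ops)
  fix Z assume Z: "Z \<in> carrier T"
  note XYZ = X Y Z
  note b = A.full_prod_bilinear B.lprod_bilinear B.rprod_bilinear B.full_prod_bilinear
  \<comment> \<open>In each of the three product laws the main terms agree by the law of
    \<open>B\<close> together with associativity in \<open>A\<close>, the correction terms agree by
    the law of \<open>A\<close>, and the cross terms vanish by \<open>tp_pt_unit\<close>. The outer
    product is expanded first, so that \<open>rc\<close> of the inner one is evaluated as a
    whole.\<close>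
  have "tp sA (lprod S) (tp sA (lprod S) X Y) Z = tp sA (lprod S) X (tp sA sB Y Z)"
    by (intro tensor_prod_assoc mods b XYZ A.full_prod_assoc B.lprod_lprod)
  then show "lprod TO (lprod TO X Y) Z = lprod TO X (full_prod K T TO Y Z)"
    unfolding full_prod_tensor[OF Y Z] ops_simps(1)[of "lprod TO X Y"]
      ops_simps(1)[of X "tp sA sB Y Z"] rc_ops(1)[OF X Y] rc_tp(3)[OF Y Z]
    using XYZ by (simp add: ops_simps(1) tp_add tp_pt_unit A.lprod_lprod)
  have "tp sA (lprod S) (tp sA (rprod S) X Y) Z = tp sA (rprod S) X (tp sA (lprod S) Y Z)"
    by (intro tensor_prod_assoc mods b XYZ A.full_prod_assoc B.rprod_lprod)
  then show "lprod TO (rprod TO X Y) Z = rprod TO X (lprod TO Y Z)"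
    unfolding ops_simps(1)[of "rprod TO X Y"]
      ops_simps(2)[of X "lprod TO Y Z"] rc_ops(1)[OF Y Z] rc_ops(2)[OF X Y]
    using XYZ by (simp add: ops_simps(1,2) tp_add tp_pt_unit A.rprod_lprod)
  have "tp sA (rprod S) (tp sA sB X Y) Z = tp sA (rprod S) X (tp sA (rprod S) Y Z)"
    by (intro tensor_prod_assoc mods b XYZ A.full_prod_assoc B.full_rprod)
  then show "rprod TO (full_prod K T TO X Y) Z = rprod TO X (rprod TO Y Z)"
    unfolding full_prod_tensor[OF X Y] ops_simps(2)[of "tp sA sB X Y"]
      ops_simps(2)[of X "rprod TO Y Z"] rc_ops(2)[OF Y Z] rc_tp(3)[OF X Y]
    using XYZ by (simp add: ops_simps(2) tp_add tp_pt_unit A.full_rprod)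
qed

text \<open>With this and \<open>lc_hom\<close>, composing a morphism into the tensor product with
  either counit map gives a morphism again, so counitality can be checked on generators.\<close>

lemma rc_hom: "dend_ops_hom K T TO A R rc"
  by (simp add: dend_ops_hom_def rc_linear rc_ops ops_simps(3,4))

lemma lc_hom: "dend_ops_hom K T TO B S lc"
  by (simp add: dend_ops_hom_def lc_linear lc_ops counit_lc ops_simps(3,4))

end

text \<open>Since \<open>g\<close> preserves the counit, \<open>f \<otimes> g\<close> is compatible
  with \<open>id \<otimes> \<epsilon>\<close> and carries correction terms to correction terms. The
  main terms need that \<open>f\<close> respects the full product.\<close>

lemma tensor_map_hom:
  assumes A: "total_dendriform K A R" and B: "total_dendriform K B S"
    and C: "total_dendriform K C P" and D: "total_dendriform K D Q"
    and f: "dend_ops_hom K A R C P f" and g: "dend_ops_hom K B S D Q g"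
  shows "dend_ops_hom K (tensor K A B) (tensor_ops K A R B S)
      (tensor K C D) (tensor_ops K C P D Q) (tensor_map K C D f g)"
    and "\<lbrakk>a \<in> carrier A; b \<in> carrier B\<rbrakk> \<Longrightarrow>
      tensor_map K C D f g (pure_tensor K A B a b) = pure_tensor K C D (f a) (g b)"
proof -
  interpret X: total_dendriform_pair K A R B S
    by (rule total_dendriform_pair.intro) fact+
  interpret Y: total_dendriform_pair K C P D Q
    by (rule total_dendriform_pair.intro) fact+
  let ?F = "tensor_map K C D f g"
  note f_lin = dend_ops_homD(1)[OF f] and g_lin = dend_ops_homD(1)[OF g]
  note f_closed [simp] = linear_mapD(1)[OF f_lin]
  note g_closed [simp] = linear_mapD(1)[OF g_lin]
  have bil: "bilinear_map K A B Y.T (\<lambda>a b. Y.pt (f a) (g b))"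
    by (rule bilinear_map_comp[OF bilinear_pure_tensor[OF Y.mods] f_lin g_lin])
  have F_lin: "linear_map K X.T Y.T ?F"
    unfolding tensor_map_def by (rule tensor_universal(1)[OF X.mods Y.T_module bil])
  show F_pure: "?F (X.pt a b) = Y.pt (f a) (g b)" if "a \<in> carrier A" "b \<in> carrier B" for a b
    unfolding tensor_map_def by (rule tensor_universal(2)[OF X.mods Y.T_module bil that])
  note F = linear_mapD[OF F_lin]
  have rc: "Y.rc (?F U) = f (X.rc U)" if U: "U \<in> carrier X.T" for U
    by (rule X.T_ext[OF Y.mods(1) linear_map_comp[OF Y.rc_linear F_lin]
          linear_map_comp[OF f_lin X.rc_linear] _ U])
      (simp add: F_pure dend_ops_homD[OF g] linear_mapD(3)[OF f_lin])
  note bl = bilinear_map_comp_linear[OF F_lin] and br = bilinear_map_comp[OF _ F_lin F_lin]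
  have tp: "?F (X.tp X.sA (lprod S) U V) = Y.tp Y.sA (lprod Q) (?F U) (?F V)"
    "?F (X.tp X.sA (rprod S) U V) = Y.tp Y.sA (rprod Q) (?F U) (?F V)"
    if UV: "U \<in> carrier X.T" "V \<in> carrier X.T" for U V
    by (rule X.T_bilinear_ext[OF Y.T_module bl[OF X.fl(1)] br[OF Y.fl(1)] _ UV],
        simp add: F_pure dend_ops_homD[OF g] dend_ops_hom_full_prod[OF A C f])
      (rule X.T_bilinear_ext[OF Y.T_module bl[OF X.fr(1)] br[OF Y.fr(1)] _ UV],
        simp add: F_pure dend_ops_homD[OF g] dend_ops_hom_full_prod[OF A C f])
  show "dend_ops_hom K X.T X.TO Y.T Y.TO ?F"
    by (simp add: dend_ops_hom_def F_lin X.ops_simps Y.ops_simps F tp F_pure rc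
        dend_ops_homD[OF f] dend_ops_homD[OF g])
qed

text \<open>On threefold pure tensors both bracketings give
  \<open>(a * a') \<otimes> (b * b') \<otimes> (c \<prec> c')\<close>, plus
  \<open>\<epsilon>(c) \<epsilon>(c')\<close> times
  \<open>(a * a') \<otimes> (b \<prec> b') \<otimes> 1\<close>, plus
  \<open>\<epsilon>(b) \<epsilon>(b') \<epsilon>(c) \<epsilon>(c')\<close> times
  \<open>(a \<prec> a') \<otimes> 1 \<otimes> 1\<close>, and likewise for \<open>\<succ>\<close>.
  Here \<open>full_prod_tensor\<close> evaluates the inner full products.\<close>

lemma tensor_assoc_hom:
  assumes A: "total_dendriform K A R" and B: "total_dendriform K B S"
    and C: "total_dendriform K C P"
  shows "dend_ops_hom K (tensor K (tensor K A B) C)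
      (tensor_ops K (tensor K A B) (tensor_ops K A R B S) C P)
      (tensor K A (tensor K B C)) (tensor_ops K A R (tensor K B C) (tensor_ops K B S C P))
      (tensor_assoc K A B C)"
    and "\<lbrakk>a \<in> carrier A; b \<in> carrier B; c \<in> carrier C\<rbrakk> \<Longrightarrow>
      tensor_assoc K A B C (pure_tensor K (tensor K A B) C (pure_tensor K A B a b) c) =
      pure_tensor K A (tensor K B C) a (pure_tensor K B C b c)"
proof -
  interpret AB: total_dendriform_pair K A R B S
    by (rule total_dendriform_pair.intro) fact+
  interpret BC: total_dendriform_pair K B S C P
    by (rule total_dendriform_pair.intro) fact+
  interpret L: total_dendriform_pair K AB.T AB.TO C P
    by (rule total_dendriform_pair.intro) (fact AB.total_dendriform_tensor, fact C)
  interpret Q: total_dendriform_pair K A R BC.T BC.TO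
    by (rule total_dendriform_pair.intro) (fact A, fact BC.total_dendriform_tensor)
  let ?F = "tensor_assoc K A B C"
  let ?G = "\<lambda>c. tensor_lift Q.T (\<lambda>a b. Q.pt a (BC.pt b c))"
  have b1: "bilinear_map K A B Q.T (\<lambda>a b. Q.pt a (BC.pt b c))" if "c \<in> carrier C" for c
    by (rule bilinear_map_comp[OF bilinear_pure_tensor[OF Q.mods] linear_map_id BC.pt_linear(1)[OF that]])
  have b2: "bilinear_map K AB.T C Q.T (\<lambda>X c. ?G c X)"
  proof (rule bilinear_mapI)
    show "linear_map K C Q.T (\<lambda>c. ?G c X)" if "X \<in> carrier AB.T" for X
      by (rule linear_map_tensor_lift[OF AB.mods Q.T_module b1
            linear_map_comp[OF Q.pt_linear(2) BC.pt_linear(2)] BC.mods(2) that])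
    show "linear_map K AB.T Q.T (?G c)" if "c \<in> carrier C" for c
      by (rule tensor_universal(1)[OF AB.mods Q.T_module b1[OF that]])
  qed
  have F_lin: "linear_map K L.T Q.T ?F"
    unfolding tensor_assoc_def by (rule tensor_universal(1)[OF L.mods Q.T_module b2])
  note F = linear_mapD[OF F_lin]
  show F_pure: "?F (L.pt (AB.pt a b) c) = Q.pt a (BC.pt b c)"
    if "a \<in> carrier A" "b \<in> carrier B" "c \<in> carrier C" for a b c
    using that tensor_universal(2)[OF L.mods Q.T_module b2, of "AB.pt a b" c]
      tensor_universal(2)[OF AB.mods Q.T_module b1, of c a b]
    by (simp add: tensor_assoc_def)
  \<comment> \<open>Bilinear extension is applied twice: first over the outer tensor product, then
    over its first factor \<open>A \<otimes> B\<close>.\<close>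
  have ext: "f X Y = g X Y"
    if f: "bilinear_map K L.T L.T Q.T f" and g: "bilinear_map K L.T L.T Q.T g"
      and pure: "\<And>a b c a' b' c'. \<lbrakk>a \<in> carrier A; b \<in> carrier B; c \<in> carrier C;
        a' \<in> carrier A; b' \<in> carrier B; c' \<in> carrier C\<rbrakk> \<Longrightarrow>
        f (L.pt (AB.pt a b) c) (L.pt (AB.pt a' b') c') = g (L.pt (AB.pt a b) c) (L.pt (AB.pt a' b') c')"
      and XY: "X \<in> carrier L.T" "Y \<in> carrier L.T" for f g X Y
  proof (rule L.T_bilinear_ext[OF Q.T_module f g _ XY])
    fix U c V c' assume UV: "U \<in> carrier AB.T" "V \<in> carrier AB.T"
      and cc: "c \<in> carrier C" "c' \<in> carrier C"
    note comp = bilinear_map_comp[OF _ L.pt_linear(1)[OF cc(1)] L.pt_linear(1)[OF cc(2)]]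
    show "f (L.pt U c) (L.pt V c') = g (L.pt U c) (L.pt V c')"
      by (rule AB.T_bilinear_ext[OF Q.T_module comp[OF f] comp[OF g] _ UV]) (simp add: pure cc)
  qed
  note bl = bilinear_map_comp_linear[OF F_lin] and br = bilinear_map_comp[OF _ F_lin F_lin]
  \<comment> \<open>Scalars are pushed into the first factor of tensors in \<open>AB\<close>, which
    keeps them in the pure form that \<open>F_pure\<close> matches; from all other pure tensors they
    are pulled out.\<close>
  note simps = F_pure F L.ops_simps(1,2) AB.ops_simps Q.ops_simps BC.ops_simps
    AB.full_prod_tensor BC.full_prod_tensor
    L.pt_add L.pt_smult AB.pt_smult(1)[symmetric] Q.pt_add Q.pt_smult BC.pt_smult BC.pt_add
    AB.A.lprod_smult AB.A.rprod_smult AB.B.lprod_smult AB.B.rprod_smult AB.A.full_prod_smult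
    AB.A.counit_smult AB.B.counit_smult
    AB.A.smult_assoc1[symmetric] AB.B.smult_assoc1[symmetric] AB.A.smult_r_distr
    L.T.smult_r_distr Q.T.smult_r_distr Q.T.smult_assoc1[symmetric] Q.T.M.a_assoc AB.A.R.m_ac
  have l: "?F (lprod L.TO X Y) = lprod Q.TO (?F X) (?F Y)"
    if XY: "X \<in> carrier L.T" "Y \<in> carrier L.T" for X Y
    by (rule ext[OF bl[OF L.ops_bilinear(1)] br[OF Q.ops_bilinear(1)] _ XY])
      (simp add: simps)
  have r: "?F (rprod L.TO X Y) = rprod Q.TO (?F X) (?F Y)"
    if XY: "X \<in> carrier L.T" "Y \<in> carrier L.T" for X Y
    by (rule ext[OF bl[OF L.ops_bilinear(2)] br[OF Q.ops_bilinear(2)] _ XY])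
      (simp add: simps)
  have c: "counit Q.TO (?F X) = counit L.TO X" if X: "X \<in> carrier L.T" for X
  proof (rule L.T_ext[OF module_regular_module[OF AB.A.is_cring] linear_map_comp[OF _ F_lin] _ _ X])
    interpret QT: total_dendriform K Q.T Q.TO by (rule Q.total_dendriform_tensor)
    interpret LT: total_dendriform K L.T L.TO by (rule L.total_dendriform_tensor)
    show "linear_map K Q.T (regular_module K) (counit Q.TO)" by (rule QT.counit_linear)
    show lin: "linear_map K L.T (regular_module K) (counit L.TO)" by (rule LT.counit_linear)
    fix U c assume U: "U \<in> carrier AB.T" and c: "c \<in> carrier C"
    show "counit Q.TO (?F (L.pt U c)) = counit L.TO (L.pt U c)"
      by (rule AB.T_ext[OF module_regular_module[OF AB.A.is_cring]
            linear_map_comp[OF linear_map_comp[OF QT.counit_linear F_lin] L.pt_linear(1)[OF c]]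
            linear_map_comp[OF LT.counit_linear L.pt_linear(1)[OF c]] _ U])
        (use c in \<open>simp add: F_pure Q.ops_simps L.ops_simps AB.ops_simps BC.ops_simps
          AB.A.counit_smult AB.B.counit_smult linear_mapD(3)[OF AB.rc_linear] AB.A.R.m_ac\<close>)
  qed
  show "dend_ops_hom K L.T L.TO Q.T Q.TO ?F"
    by (simp add: dend_ops_hom_def F_lin l r c)
      (simp add: F_pure L.ops_simps AB.ops_simps Q.ops_simps BC.ops_simps)
qed

section \<open>The unitization of a dendriform algebra\<close>

definition unital_ops ::
  "('k, 'm) ring_scheme \<Rightarrow> ('k, 'a, 'p) udendriform_scheme \<Rightarrow> ('k, 'a) dend_ops"
  where "unital_ops K W =
    \<lparr>lprod = prec0 K W, rprod = succ0 K W, unit = \<one>\<^bsub>W\<^esub>, counit = unit_coeff K W\<rparr>"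

lemma unital_ops_simps [simp]:
  "lprod (unital_ops K W) = prec0 K W"
  "rprod (unital_ops K W) = succ0 K W"
  "unit (unital_ops K W) = \<one>\<^bsub>W\<^esub>"
  "counit (unital_ops K W) = unit_coeff K W"
  by (simp_all add: unital_ops_def)

lemma full_prod_unital_ops: "full_prod K W (unital_ops K W) = star K W"
  by (simp add: full_prod_def star_def fun_eq_iff)

context dendriform_algebra
begin

abbreviation "U \<equiv> unitization K D"

lemma dend_closed [simp]:
  "\<lbrakk>x \<in> carrier D; y \<in> carrier D\<rbrakk> \<Longrightarrow> x \<prec>\<^bsub>D\<^esub> y \<in> carrier D"
  "\<lbrakk>x \<in> carrier D; y \<in> carrier D\<rbrakk> \<Longrightarrow> x \<succ>\<^bsub>D\<^esub> y \<in> carrier D"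
  by (rule bilinear_mapD(3)[OF prec_bilinear] bilinear_mapD(3)[OF succ_bilinear]; assumption)+

lemmas dend_linear = bilinear_mapD(1)[OF prec_bilinear] bilinear_mapD(2)[OF prec_bilinear]
  bilinear_mapD(1)[OF succ_bilinear] bilinear_mapD(2)[OF succ_bilinear]
lemmas dend_add = dend_linear[THEN linear_mapD(2)]
  and dend_smult = dend_linear[THEN linear_mapD(3)]
  and dend_zero [simp] = dend_linear[THEN linear_map_zero[OF module_axioms module_axioms]]

lemma U_simps:
  "carrier U = carrier K \<times> carrier D"
  "\<one>\<^bsub>U\<^esub> = (\<one>\<^bsub>K\<^esub>, \<zero>\<^bsub>D\<^esub>)"
  "\<zero>\<^bsub>U\<^esub> = (\<zero>\<^bsub>K\<^esub>, \<zero>\<^bsub>D\<^esub>)"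
  "(a, x) \<oplus>\<^bsub>U\<^esub> (b, y) = (a \<oplus>\<^bsub>K\<^esub> b, x \<oplus>\<^bsub>D\<^esub> y)"
  "c \<odot>\<^bsub>U\<^esub> (a, x) = (c \<otimes>\<^bsub>K\<^esub> a, c \<odot>\<^bsub>D\<^esub> x)"
  "(a, x) \<prec>\<^bsub>U\<^esub> (b, y) = (\<zero>\<^bsub>K\<^esub>, b \<odot>\<^bsub>D\<^esub> x \<oplus>\<^bsub>D\<^esub> x \<prec>\<^bsub>D\<^esub> y)"
  "(a, x) \<succ>\<^bsub>U\<^esub> (b, y) = (\<zero>\<^bsub>K\<^esub>, a \<odot>\<^bsub>D\<^esub> y \<oplus>\<^bsub>D\<^esub> x \<succ>\<^bsub>D\<^esub> y)"
  "aug U = {\<zero>\<^bsub>K\<^esub>} \<times> carrier D"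
  by (simp_all add: unitization_def)

lemma unital_dendriform_algebra_U: "unital_dendriform_algebra K U"
  by (rule unital_dendriform_algebra_unitization) (rule dendriform_algebra_axioms)

lemma module_U: "module K U"
  using unital_dendriform_algebra_U by (simp add: unital_dendriform_algebra_def)

lemma unit_coeff_U [simp]:
  "\<lbrakk>a \<in> carrier K; x \<in> carrier D\<rbrakk> \<Longrightarrow> unit_coeff K U (a, x) = a"
  unfolding unit_coeff_def by (rule the_equality) (auto simp: U_simps)

lemma aug_part_U [simp]:
  "\<lbrakk>a \<in> carrier K; x \<in> carrier D\<rbrakk> \<Longrightarrow> aug_part K U (a, x) = (\<zero>\<^bsub>K\<^esub>, x)"
  unfolding aug_part_def by (rule the_equality) (auto simp: U_simps)

lemma prec0_U [simp]:
  "\<lbrakk>a \<in> carrier K; x \<in> carrier D; b \<in> carrier K; y \<in> carrier D\<rbrakk> \<Longrightarrow>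
    prec0 K U (a, x) (b, y) = (\<zero>\<^bsub>K\<^esub>, b \<odot>\<^bsub>D\<^esub> x \<oplus>\<^bsub>D\<^esub> x \<prec>\<^bsub>D\<^esub> y)"
  by (simp add: prec0_def U_simps)

lemma succ0_U [simp]:
  "\<lbrakk>a \<in> carrier K; x \<in> carrier D; b \<in> carrier K; y \<in> carrier D\<rbrakk> \<Longrightarrow>
    succ0 K U (a, x) (b, y) = (\<zero>\<^bsub>K\<^esub>, a \<odot>\<^bsub>D\<^esub> y \<oplus>\<^bsub>D\<^esub> x \<succ>\<^bsub>D\<^esub> y)"
  by (simp add: succ0_def U_simps M.a_comm)

lemma star_U [simp]:
  "\<lbrakk>a \<in> carrier K; x \<in> carrier D; b \<in> carrier K; y \<in> carrier D\<rbrakk> \<Longrightarrow>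
    star K U (a, x) (b, y) =
      (a \<otimes>\<^bsub>K\<^esub> b, (b \<odot>\<^bsub>D\<^esub> x \<oplus>\<^bsub>D\<^esub> x \<prec>\<^bsub>D\<^esub> y) \<oplus>\<^bsub>D\<^esub> (a \<odot>\<^bsub>D\<^esub> y \<oplus>\<^bsub>D\<^esub> x \<succ>\<^bsub>D\<^esub> y))"
  by (simp add: star_def U_simps)

text \<open>In the coordinates \<open>(a, x)\<close> of \<open>K \<cdot> 1 \<oplus> D\<close> the
  product laws reduce to the dendriform axioms of \<open>D\<close>, and the additional terms with a
  unit component match by bilinearity.\<close>

lemma total_dendriform_U: "total_dendriform K U (unital_ops K U)"
proof -
  note simps = U_simps full_prod_unital_ops M.a_ac m_ac cring.cring_simprules(7,10)[OF is_cring]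
    smult_l_distr smult_r_distr l_distr r_distr smult_assoc1[symmetric]
    dend_add dend_smult prec_prec succ_prec succ_succ
  show ?thesis
    by (intro total_dendriform.intro total_dendriform_axioms.intro module_U bilinear_mapI linear_mapI)
      (auto simp: simps)
qed

end

section \<open>Morphisms out of the free dendriform algebra\<close>

text \<open>The kernel of the counit is an ordinary dendriform algebra containing the values of
  \<open>\<phi>\<close>. The universal property gives a morphism \<open>g\<close> into it, and
  sending \<open>1\<close> to the unit extends \<open>g\<close> to the unitization.\<close>

lemma dend_ops_hom_exists:
  fixes K :: "('k, 'm) ring_scheme" and V :: "('k, 'v, 'p) module_scheme"
    and N :: "('k, 'a, 'q) module_scheme"
  assumes "field K" and V: "module K V" and N: "total_dendriform K N S"
    and \<phi>: "linear_map K V N \<phi>" and \<phi>0: "\<And>v. v \<in> carrier V \<Longrightarrow> counit S (\<phi> v) = \<zero>\<^bsub>K\<^esub>"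
  obtains f where
    "dend_ops_hom K (free_unital K V) (unital_ops K (free_unital K V)) N S f"
    "\<And>v. v \<in> carrier V \<Longrightarrow> f (\<zero>\<^bsub>K\<^esub>, free_gen K V v) = \<phi> v"
proof -
  interpret N: total_dendriform K N S by fact
  interpret D: dendriform_algebra K "free_dendriform K V"
    by (rule dendriform_algebra_free_dendriform) fact+
  \<comment> \<open>The augmentation ideal of \<open>N\<close>.\<close>
  define E :: "('k, 'a) dendriform" where "E = \<lparr>carrier = {x \<in> carrier N. counit S x = \<zero>\<^bsub>K\<^esub>}, mult = undefined,
    one = undefined, zero = \<zero>\<^bsub>N\<^esub>, add = add N, smult = smult N, prec = lprod S, succ = rprod S\<rparr>"
  have E_simps: "carrier E = {x \<in> carrier N. counit S x = \<zero>\<^bsub>K\<^esub>}" "\<zero>\<^bsub>E\<^esub> = \<zero>\<^bsub>N\<^esub>"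
    "add E = add N" "smult E = smult N" "prec E = lprod S" "succ E = rprod S"
    by (simp_all add: E_def)
  have c0: "counit S \<zero>\<^bsub>N\<^esub> = \<zero>\<^bsub>K\<^esub>"
    using linear_map_zero[OF N.module_W module_regular_module[OF N.is_cring] N.counit_linear] by simp
  have "abelian_group E"
  proof (rule abelian_groupI)
    fix x assume "x \<in> carrier E"
    then have x: "x \<in> carrier N" "counit S x = \<zero>\<^bsub>K\<^esub>" by (simp_all add: E_simps)
    have "(\<ominus>\<^bsub>K\<^esub> \<one>\<^bsub>K\<^esub>) \<odot>\<^bsub>N\<^esub> x \<oplus>\<^bsub>N\<^esub> x = (\<ominus>\<^bsub>K\<^esub> \<one>\<^bsub>K\<^esub> \<oplus>\<^bsub>K\<^esub> \<one>\<^bsub>K\<^esub>) \<odot>\<^bsub>N\<^esub> x"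
      using x by (simp add: N.smult_l_distr)
    then show "\<exists>y\<in>carrier E. y \<oplus>\<^bsub>E\<^esub> x = \<zero>\<^bsub>E\<^esub>"
      using x by (intro bexI[of _ "(\<ominus>\<^bsub>K\<^esub> \<one>\<^bsub>K\<^esub>) \<odot>\<^bsub>N\<^esub> x"])
        (simp_all add: E_simps N.counit_smult N.R.l_neg)
  qed (auto simp: E_simps c0 N.counit_add N.M.a_ac)
  then have "module K E"
    by (intro moduleI N.is_cring)
      (auto simp: E_simps N.counit_smult N.smult_l_distr N.smult_r_distr N.smult_assoc1)
  \<comment> \<open>On \<open>E\<close> the counit term of \<open>full_prod\<close> is zero, so the
    laws of \<open>N\<close> become the dendriform axioms.\<close>
  then have "dendriform_algebra K E"
    by (intro dendriform_algebra.intro dendriform_algebra_axioms.intro assms(1) bilinear_mapI linear_mapI)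
      (auto simp: E_simps N.lprod_add N.rprod_add N.lprod_smult N.rprod_smult N.lprod_lprod
        N.rprod_lprod N.full_rprod[symmetric] full_prod_def N.M.a_comm)
  moreover have "linear_map K V E \<phi>"
    using \<phi> \<phi>0 by (auto simp: linear_map_def E_simps)
  ultimately obtain g where g: "dend_hom K (free_dendriform K V) E g"
    and gen: "\<And>v. v \<in> carrier V \<Longrightarrow> g (free_gen K V v) = \<phi> v"
    using free_dendriform_universal[OF V] by blast
  have g_lin: "linear_map K (free_dendriform K V) E g"
    and g_prod: "\<And>x y. \<lbrakk>x \<in> carrier (free_dendriform K V); y \<in> carrier (free_dendriform K V)\<rbrakk> \<Longrightarrow>
      g (x \<prec>\<^bsub>free_dendriform K V\<^esub> y) = lprod S (g x) (g y) \<and>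
      g (x \<succ>\<^bsub>free_dendriform K V\<^esub> y) = rprod S (g x) (g y)"
    using g by (auto simp: dend_hom_def E_simps)
  have g_in: "g x \<in> carrier N" "counit S (g x) = \<zero>\<^bsub>K\<^esub>" if "x \<in> carrier (free_dendriform K V)" for x
    using linear_mapD(1)[OF g_lin that] by (simp_all add: E_simps)
  have g_add: "g (x \<oplus>\<^bsub>free_dendriform K V\<^esub> y) = g x \<oplus>\<^bsub>N\<^esub> g y"
    if "x \<in> carrier (free_dendriform K V)" "y \<in> carrier (free_dendriform K V)" for x y
    using linear_mapD(2)[OF g_lin that] by (simp add: E_simps)
  have g_smult: "g (c \<odot>\<^bsub>free_dendriform K V\<^esub> x) = c \<odot>\<^bsub>N\<^esub> g x"
    if "c \<in> carrier K" "x \<in> carrier (free_dendriform K V)" for c x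
    using linear_mapD(3)[OF g_lin that] by (simp add: E_simps)
  have g_zero: "g \<zero>\<^bsub>free_dendriform K V\<^esub> = \<zero>\<^bsub>N\<^esub>"
    using linear_map_zero[OF D.module_axioms \<open>module K E\<close> g_lin] by (simp add: E_simps)
  \<comment> \<open>For the same reason the unit laws on \<open>E\<close> lose their counit term;
    they handle the mixed products of \<open>1\<close> with values of \<open>g\<close>.\<close>
  have lu: "lprod S x (unit S) = x" and ur: "rprod S (unit S) x = x"
    if "x \<in> carrier N" "counit S x = \<zero>\<^bsub>K\<^esub>" for x
    using N.lprod_unit[OF that(1)] N.unit_rprod[OF that(1)] that by simp_all
  define f where "f = (\<lambda>(a, x). a \<odot>\<^bsub>N\<^esub> unit S \<oplus>\<^bsub>N\<^esub> g x)"
  have "linear_map K D.U N f"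
    by (rule linear_mapI)
      (auto simp: f_def D.U_simps g_in g_add g_smult N.smult_l_distr N.smult_r_distr
        N.smult_assoc1 N.M.a_ac)
  then have "dend_ops_hom K D.U (unital_ops K D.U) N S f"
    by (auto simp: dend_ops_hom_def f_def D.U_simps g_in g_add g_smult g_prod g_zero
        N.lprod_add N.rprod_add N.lprod_smult N.rprod_smult N.counit_add N.counit_smult lu ur)
  moreover have "f (\<zero>\<^bsub>K\<^esub>, free_gen K V v) = \<phi> v" if "v \<in> carrier V" for v
    using that linear_mapD(1)[OF \<phi>] by (simp add: f_def gen)
  ultimately show ?thesis by (rule that)
qed

section \<open>Induction and uniqueness of morphisms on the unital free algebra\<close>

locale free_dend =
  fixes K :: "('k, 'm) ring_scheme" and V :: "('k, 'v, 'p) module_scheme"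
  assumes field_K: "field K" and module_V: "module K V"
begin

abbreviation "D \<equiv> free_dendriform K V"
abbreviation "W \<equiv> free_unital K V"
abbreviation "S \<equiv> unital_ops K W"
abbreviation "gen v \<equiv> (\<zero>\<^bsub>K\<^esub>, free_gen K V v)"

sublocale D: dendriform_algebra K D
  by (rule dendriform_algebra_free_dendriform[OF field_K module_V])

sublocale W: total_dendriform K W S
  by (rule D.total_dendriform_U)

lemma free_gen_closed [simp]: "v \<in> carrier V \<Longrightarrow> free_gen K V v \<in> carrier D"
  by (rule linear_mapD(1)[OF linear_free_gen[OF module_V]])

lemma gen_closed [simp]: "v \<in> carrier V \<Longrightarrow> gen v \<in> carrier W"
  by (simp add: D.U_simps)

lemma gen_linear: "linear_map K V W gen"
  by (rule linear_mapI) (simp_all add: D.U_simps linear_mapD[OF linear_free_gen[OF module_V]])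

text \<open>Every element is a multiple of \<open>1\<close> plus the class of a term, and each term
  constructor is matched by a hypothesis on \<open>P\<close>.\<close>

lemma free_induct [consumes 1, case_names one gen add smult lprod rprod]:
  assumes "x \<in> carrier W"
    and one: "P \<one>\<^bsub>W\<^esub>"
    and gen: "\<And>v. v \<in> carrier V \<Longrightarrow> P (gen v)"
    and add: "\<And>x y. \<lbrakk>x \<in> carrier W; y \<in> carrier W; P x; P y\<rbrakk> \<Longrightarrow> P (x \<oplus>\<^bsub>W\<^esub> y)"
    and smult: "\<And>c x. \<lbrakk>c \<in> carrier K; x \<in> carrier W; P x\<rbrakk> \<Longrightarrow> P (c \<odot>\<^bsub>W\<^esub> x)"
    and lprod: "\<And>x y. \<lbrakk>x \<in> carrier W; y \<in> carrier W; P x; P y\<rbrakk> \<Longrightarrow> P (lprod S x y)"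
    and rprod: "\<And>x y. \<lbrakk>x \<in> carrier W; y \<in> carrier W; P x; P y\<rbrakk> \<Longrightarrow> P (rprod S x y)"
  shows "P x"
proof -
  have cl: "dend_class K V t \<in> carrier D" if "t \<in> dterms K V" for t
    using that by (simp add: free_dendriform_simps)
  have D: "P (\<zero>\<^bsub>K\<^esub>, dend_class K V t)" if "t \<in> dterms K V" for t
    using that
  proof induction
    case zero
    \<comment> \<open>Zero is reached as \<open>0 \<cdot> 1\<close>.\<close>
    have "P (\<zero>\<^bsub>K\<^esub> \<odot>\<^bsub>W\<^esub> \<one>\<^bsub>W\<^esub>)" by (rule smult[OF _ _ one]) (simp_all add: D.U_simps)
    then show ?case by (simp add: D.U_simps) (simp add: free_dendriform_simps)
  next
    case (gen v)
    then show ?case using assms(3)[of v] by (simp add: free_gen_def)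
  next
    case (add s t)
    then show ?case
      using assms(4)[of "(\<zero>\<^bsub>K\<^esub>, dend_class K V s)" "(\<zero>\<^bsub>K\<^esub>, dend_class K V t)"]
      by (simp add: D.U_simps cl) (simp add: free_dendriform_simps)
  next
    case (smult c t)
    then show ?case
      using assms(5)[of c "(\<zero>\<^bsub>K\<^esub>, dend_class K V t)"]
      by (simp add: D.U_simps cl) (simp add: free_dendriform_simps)
  next
    case (prec s t)
    then show ?case
      using lprod[of "(\<zero>\<^bsub>K\<^esub>, dend_class K V s)" "(\<zero>\<^bsub>K\<^esub>, dend_class K V t)"]
      by (simp add: D.U_simps cl) (simp add: free_dendriform_simps)
  next
    case (succ s t)
    then show ?case
      using rprod[of "(\<zero>\<^bsub>K\<^esub>, dend_class K V s)" "(\<zero>\<^bsub>K\<^esub>, dend_class K V t)"]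
      by (simp add: D.U_simps cl) (simp add: free_dendriform_simps)
  qed
  obtain a t where x: "x = (a, dend_class K V t)" "a \<in> carrier K" "t \<in> dterms K V"
    using assms(1) by (auto simp: D.U_simps free_dendriform_simps)
  have one_in: "\<one>\<^bsub>W\<^esub> \<in> carrier W" by (simp add: D.U_simps)
  have "P (a \<odot>\<^bsub>W\<^esub> \<one>\<^bsub>W\<^esub>)" by (rule smult[OF x(2) one_in one])
  then have "P (a \<odot>\<^bsub>W\<^esub> \<one>\<^bsub>W\<^esub> \<oplus>\<^bsub>W\<^esub> (\<zero>\<^bsub>K\<^esub>, dend_class K V t))"
    by (rule add[rotated 2]) (use x one_in in \<open>simp_all add: D cl D.U_simps\<close>)
  then show ?thesis using x by (simp add: D.U_simps cl)
qed

text \<open>This reduces the counit laws and coassociativity, all equalities of morphisms out of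
  \<open>W\<close>, to the generators.\<close>

lemma hom_ext:
  assumes N: "total_dendriform K N Q"
    and f: "dend_ops_hom K W S N Q f" and g: "dend_ops_hom K W S N Q g"
    and gen: "\<And>v. v \<in> carrier V \<Longrightarrow> f (gen v) = g (gen v)"
    and x: "x \<in> carrier W"
  shows "f x = g x"
  using x
proof (induction rule: free_induct)
  case one
  then show ?case using dend_ops_homD(4)[OF f] dend_ops_homD(4)[OF g] by simp
qed (simp_all add: gen dend_ops_homD(2,3)[OF f] dend_ops_homD(2,3)[OF g]
    linear_mapD[OF dend_ops_homD(1)[OF f]] linear_mapD[OF dend_ops_homD(1)[OF g]]
    del: unital_ops_simps)

section \<open>Spanning of the free algebra by iterated \<open>\<or>\<close>\<close>

lemma vee_eq:
  "\<lbrakk>v \<in> carrier V; x \<in> carrier W; y \<in> carrier W\<rbrakk> \<Longrightarrow>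
    vee K V v x y = lprod S (rprod S x (gen v)) y"
  by (auto simp: vee_def D.U_simps)

text \<open>Sums and scalar multiples are built into the rules, so the induction principle matches
  the data of the Loday--Ronco recursion: the value at \<open>1\<close>, linearity, and the value at
  \<open>x \<or> y\<close>.\<close>

inductive_set vee_span :: "('k \<times> ('k, 'v) dterm set) set" where
  one: "\<one>\<^bsub>W\<^esub> \<in> vee_span"
| add: "\<lbrakk>x \<in> vee_span; y \<in> vee_span\<rbrakk> \<Longrightarrow> x \<oplus>\<^bsub>W\<^esub> y \<in> vee_span"
| smult: "\<lbrakk>c \<in> carrier K; x \<in> vee_span\<rbrakk> \<Longrightarrow> c \<odot>\<^bsub>W\<^esub> x \<in> vee_span"
| vee: "\<lbrakk>v \<in> carrier V; x \<in> vee_span; y \<in> vee_span\<rbrakk> \<Longrightarrow>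
    lprod S (rprod S x (gen v)) y \<in> vee_span"

lemma one_closed [simp]: "\<one>\<^bsub>W\<^esub> \<in> carrier W"
  using W.unit_in by simp

lemma vee_span_closed [simp]: "x \<in> vee_span \<Longrightarrow> x \<in> carrier W"
  by (induction rule: vee_span.induct) (simp_all del: unital_ops_simps)

lemma vee_span_zero: "\<zero>\<^bsub>W\<^esub> \<in> vee_span"
  using vee_span.smult[OF _ vee_span.one, of "\<zero>\<^bsub>K\<^esub>"] by simp

text \<open>Outer factors are absorbed into the branches:
  \<open>z \<succ> (x \<or> y) = (z * x) \<or> y\<close> here, and
  \<open>(x \<or> y) \<prec> z = x \<or> (y * z)\<close> in \<open>lprod_vee\<close>.\<close>

lemma rprod_vee:
  assumes "v \<in> carrier V" "x \<in> carrier W" "y \<in> carrier W" "z \<in> carrier W"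
  shows "rprod S z (lprod S (rprod S x (gen v)) y) =
    lprod S (rprod S (full_prod K W S z x) (gen v)) y"
  using assms by (simp add: W.rprod_lprod[symmetric] W.full_rprod del: unital_ops_simps)

lemma lprod_vee:
  assumes "v \<in> carrier V" "x \<in> carrier W" "y \<in> carrier W" "z \<in> carrier W"
  shows "lprod S (lprod S (rprod S x (gen v)) y) z =
    lprod S (rprod S x (gen v)) (full_prod K W S y z)"
  using assms by (simp add: W.lprod_lprod del: unital_ops_simps)

text \<open>For \<open>x = a \<or> b\<close> and \<open>y = c \<or> d\<close> one has
  \<open>x \<prec> y = a \<or> (b * y)\<close> and \<open>x \<succ> y = (x * c) \<or> d\<close>. The
  outer induction, with \<open>y\<close> arbitrary, covers \<open>b * y\<close>; the inner one, with
  \<open>x\<close> fixed, covers \<open>x * c\<close>.\<close>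

lemma vee_span_full_prod:
  assumes "x \<in> vee_span" "y \<in> vee_span"
  shows "full_prod K W S x y \<in> vee_span"
  using assms
proof (induction arbitrary: y rule: vee_span.induct)
  case one
  then show ?case using W.full_prod_unit(2)[of y] by simp
next
  case (add x x')
  then show ?case by (simp add: W.full_prod_add vee_span.add)
next
  case (smult c x)
  then show ?case by (simp add: W.full_prod_smult vee_span.smult)
next
  case (vee v a b)
  let ?x = "lprod S (rprod S a (gen v)) b"
  have x: "?x \<in> vee_span" using vee.hyps by (rule vee_span.vee)
  from vee.prems show ?case
  proof (induction rule: vee_span.induct)
    case one
    then show ?case using W.full_prod_unit(1)[OF vee_span_closed[OF x]] x by simp
  next
    case (add y y')
    then show ?case using x by (simp add: W.full_prod_add vee_span.add del: unital_ops_simps)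
  next
    case (smult c y)
    then show ?case using x by (simp add: W.full_prod_smult vee_span.smult del: unital_ops_simps)
  next
    case (vee w c d)
    let ?y = "lprod S (rprod S c (gen w)) d"
    have y: "?y \<in> vee_span" using vee.hyps by (rule vee_span.vee)
    have "lprod S ?x ?y \<in> vee_span"
      using vee.hyps \<open>v \<in> carrier V\<close> \<open>a \<in> vee_span\<close> \<open>b \<in> vee_span\<close> y \<open>\<And>y. y \<in> vee_span \<Longrightarrow> full_prod K W S b y \<in> vee_span\<close>
      by (simp add: lprod_vee vee_span.vee del: unital_ops_simps)
    moreover have "rprod S ?x ?y \<in> vee_span"
      using vee.hyps vee.IH x by (simp add: rprod_vee vee_span.vee del: unital_ops_simps)
    moreover have "(counit S ?x \<otimes>\<^bsub>K\<^esub> counit S ?y) \<odot>\<^bsub>W\<^esub> unit S \<in> vee_span"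
      using x y vee_span.smult[OF _ vee_span.one] by (simp del: unital_ops_simps(1,2,4))
    ultimately show ?case by (simp add: full_prod_def vee_span.add del: unital_ops_simps)
  qed
qed

lemma vee_span_lprod:
  assumes "x \<in> vee_span" "y \<in> vee_span"
  shows "lprod S x y \<in> vee_span"
  using assms
proof (induction rule: vee_span.induct)
  case one
  then show ?case using W.unit_lprod[of y] vee_span_zero by simp
qed (simp_all add: W.lprod_add W.lprod_smult lprod_vee vee_span.intros vee_span_full_prod
    del: unital_ops_simps)

lemma vee_span_rprod:
  assumes "x \<in> vee_span" "y \<in> vee_span"
  shows "rprod S x y \<in> vee_span"
  using assms(2,1)
proof (induction rule: vee_span.induct)
  case one
  then show ?case using W.rprod_unit[of x] vee_span_zero by simp
qed (simp_all add: W.rprod_add W.rprod_smult rprod_vee vee_span.intros vee_span_full_prod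
    del: unital_ops_simps)

lemma vee_span_eq: "vee_span = carrier W"
proof
  show "carrier W \<subseteq> vee_span"
  proof
    fix x assume "x \<in> carrier W"
    then show "x \<in> vee_span"
    proof (induction rule: free_induct)
      case (gen v)
      \<comment> \<open>A generator is \<open>1 \<or> 1\<close> with that generator as
        label.\<close>
      have "lprod S (rprod S \<one>\<^bsub>W\<^esub> (gen v)) \<one>\<^bsub>W\<^esub> = gen v"
        using gen by (simp add: D.U_simps)
      then show ?case
        using vee_span.vee[OF gen vee_span.one vee_span.one] by simp
    qed (simp_all add: vee_span.intros vee_span_lprod vee_span_rprod del: unital_ops_simps)
  qed
qed (auto simp del: unital_ops_simps)

section \<open>The Loday--Ronco coproduct as a morphism\<close>

sublocale WW: total_dendriform_pair K W S W S
  by unfold_locales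

lemma is_LR_coproductD:
  assumes "is_LR_coproduct K V f"
  shows "linear_map K W WW.T f"
    and "f \<one>\<^bsub>W\<^esub> = WW.pt \<one>\<^bsub>W\<^esub> \<one>\<^bsub>W\<^esub>"
    and "\<lbrakk>v \<in> carrier V; x \<in> carrier W; y \<in> carrier W\<rbrakk> \<Longrightarrow>
      f (vee K V v x y) = WW.pt (vee K V v x y) \<one>\<^bsub>W\<^esub> \<oplus>\<^bsub>WW.T\<^esub>
        sweedler_prod K W (star K W) (vee K V v) (f x) (f y)"
  using assms by (auto simp only: is_LR_coproduct_def Let_def)

lemma is_LR_coproduct_unique:
  assumes f: "is_LR_coproduct K V f" and g: "is_LR_coproduct K V g" and x: "x \<in> carrier W"
  shows "f x = g x"
  using x unfolding vee_span_eq[symmetric]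
proof (induction rule: vee_span.induct)
  case one
  then show ?case by (simp only: is_LR_coproductD(2)[OF f] is_LR_coproductD(2)[OF g])
next
  case (vee v a b)
  then have ab: "a \<in> carrier W" "b \<in> carrier W" by simp_all
  have "f (vee K V v a b) = g (vee K V v a b)"
    by (simp only: is_LR_coproductD(3)[OF f vee.hyps(1) ab] is_LR_coproductD(3)[OF g vee.hyps(1) ab] vee.IH)
  then show ?case by (simp only: vee_eq[OF vee.hyps(1) ab])
qed (simp_all add: linear_mapD[OF is_LR_coproductD(1)[OF f]] linear_mapD[OF is_LR_coproductD(1)[OF g]])

text \<open>Apply \<open>f\<close> to \<open>x \<or> y = (x \<succ> v) \<prec> y\<close>. In the
  main term \<open>v \<otimes> 1\<close> is killed, since \<open>b \<succ> 1 = 0\<close>, while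
  \<open>1 \<otimes> v\<close> leaves the first components untouched and grafts the second ones onto
  \<open>v\<close>. The correction term is \<open>(x \<or> y) \<otimes> 1\<close> by the right
  counit law.\<close>

lemma hom_is_LR_coproduct:
  assumes f: "dend_ops_hom K W S WW.T WW.TO f"
    and gen: "\<And>v. v \<in> carrier V \<Longrightarrow>
      f (gen v) = WW.pt (gen v) \<one>\<^bsub>W\<^esub> \<oplus>\<^bsub>WW.T\<^esub> WW.pt \<one>\<^bsub>W\<^esub> (gen v)"
  shows "is_LR_coproduct K V f"
proof -
  interpret T: total_dendriform K WW.T WW.TO by (rule WW.total_dendriform_tensor)
  note fc = linear_mapD(1)[OF dend_ops_homD(1)[OF f]]
  \<comment> \<open>Both sides are endomorphisms of \<open>W\<close>, and
    \<open>id \<otimes> \<epsilon>\<close> maps \<open>v \<otimes> 1 + 1 \<otimes> v\<close> to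
    \<open>v\<close>.\<close>
  have rc: "WW.rc (f x) = x" if "x \<in> carrier W" for x
    by (rule hom_ext[OF W.total_dendriform_axioms dend_ops_hom_comp[OF f WW.rc_hom] dend_ops_hom_id _ that])
      (simp add: gen WW.rc_add D.U_simps)
  have vee_bil: "bilinear_map K W W W (\<lambda>x y. lprod S (rprod S x (gen v)) y)" if "v \<in> carrier V" for v
    using bilinear_map_comp[OF W.lprod_bilinear bilinear_mapD(2)[OF W.rprod_bilinear] linear_map_id] that
    by simp
  have "f (vee K V v x y) = WW.pt (vee K V v x y) \<one>\<^bsub>W\<^esub> \<oplus>\<^bsub>WW.T\<^esub>
      sweedler_prod K W (star K W) (vee K V v) (f x) (f y)"
    if x: "x \<in> carrier W" and y: "y \<in> carrier W" and v: "v \<in> carrier V" for x y v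
  proof -
    let ?v = "\<lambda>x y. lprod S (rprod S x (gen v)) y"
    note vee = tensor_prod[OF WW.mods W.full_prod_bilinear vee_bil[OF v]]
    have c: "f (gen v) \<in> carrier WW.T" using v fc by simp
    have e: "WW.tp (full_prod K W S) (lprod S) (WW.tp (full_prod K W S) (rprod S) X (f (gen v))) Y =
        WW.tp (full_prod K W S) ?v X Y" if XY: "X \<in> carrier WW.T" "Y \<in> carrier WW.T" for X Y
    proof (rule WW.T_bilinear_ext[OF WW.T_module _ vee(1) _ XY])
      show "bilinear_map K WW.T WW.T WW.T (\<lambda>X. WW.tp (full_prod K W S) (lprod S)
          (WW.tp (full_prod K W S) (rprod S) X (f (gen v))))"
        by (rule bilinear_map_comp[OF WW.fl(1) bilinear_mapD(2)[OF WW.fr(1) c] linear_map_id])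
      fix a b a' b' assume ab: "a \<in> carrier W" "b \<in> carrier W" "a' \<in> carrier W" "b' \<in> carrier W"
      \<comment> \<open>Writing \<open>1\<close> as \<open>unit S\<close> lets
        \<open>tp_pt_unit\<close> and the unit laws apply while \<open>unital_ops_simps\<close> is
        switched off.\<close>
      have u: "WW.pt (gen v) \<one>\<^bsub>W\<^esub> = WW.pt (gen v) (unit S)" "WW.pt \<one>\<^bsub>W\<^esub> (gen v) = WW.pt (unit S) (gen v)"
        by simp_all
      show "WW.tp (full_prod K W S) (lprod S)
          (WW.tp (full_prod K W S) (rprod S) (WW.pt a b) (f (gen v))) (WW.pt a' b') =
        WW.tp (full_prod K W S) ?v (WW.pt a b) (WW.pt a' b')"
        using ab v vee(2)
        by (simp add: gen[OF v, unfolded u] WW.tp_add WW.tp_pt_unit del: unital_ops_simps)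
    qed
    have "f (vee K V v x y) = lprod WW.TO (rprod WW.TO (f x) (f (gen v))) (f y)"
      using x y v by (simp add: vee_eq dend_ops_homD[OF f] del: unital_ops_simps)
    also have "\<dots> = WW.tp (full_prod K W S) (lprod S)
        (WW.tp (full_prod K W S) (rprod S) (f x) (f (gen v))) (f y) \<oplus>\<^bsub>WW.T\<^esub>
        WW.pt (vee K V v x y) (unit S)"
      unfolding WW.ops_simps(1)[of "rprod WW.TO (f x) (f (gen v))"] WW.rc_ops(2)[OF fc[OF x] c]
      using x y v c fc[OF x] fc[OF y]
      by (simp add: WW.ops_simps(2) WW.tp_add WW.tp_pt_unit rc vee_eq del: unital_ops_simps)
    also have "\<dots> = WW.tp (full_prod K W S) ?v (f x) (f y) \<oplus>\<^bsub>WW.T\<^esub> WW.pt (vee K V v x y) (unit S)"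
      using e fc x y by simp
    also have "\<dots> = WW.pt (vee K V v x y) (unit S) \<oplus>\<^bsub>WW.T\<^esub> WW.tp (full_prod K W S) ?v (f x) (f y)"
      using x y v fc[OF x] fc[OF y] bilinear_mapD(3)[OF vee(1)]
      by (intro WW.T.M.a_comm) (simp_all add: vee_eq del: unital_ops_simps)
    \<comment> \<open>The two descriptions of \<open>\<or>\<close> are known to agree on
      \<open>carrier W\<close> only, so they are exchanged on pure tensors and not as
      functions.\<close>
    also have "WW.tp (full_prod K W S) ?v (f x) (f y) = WW.tp (full_prod K W S) (vee K V v) (f x) (f y)"
    proof (rule WW.T_bilinear_ext[OF WW.T_module vee(1) _ _ fc[OF x] fc[OF y]])
      have vb: "bilinear_map K W W W (vee K V v)"
        using vee_bil[OF v] v by (simp add: bilinear_map_def linear_map_def vee_eq Pi_iff del: unital_ops_simps)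
      show "bilinear_map K WW.T WW.T WW.T (WW.tp (full_prod K W S) (vee K V v))"
        by (rule tensor_prod(1)[OF WW.mods W.full_prod_bilinear vb])
      show "WW.tp (full_prod K W S) ?v (WW.pt a b) (WW.pt a' b') =
          WW.tp (full_prod K W S) (vee K V v) (WW.pt a b) (WW.pt a' b')"
        if "a \<in> carrier W" "b \<in> carrier W" "a' \<in> carrier W" "b' \<in> carrier W" for a b a' b'
        using that v vee(2) tensor_prod(2)[OF WW.mods W.full_prod_bilinear vb]
        by (simp add: vee_eq del: unital_ops_simps)
    qed
    finally show ?thesis by (simp add: sweedler_prod_eq full_prod_unital_ops)
  qed
  then show ?thesis
    using dend_ops_homD(1,4)[OF f] WW.ops_simps(3) by (simp add: is_LR_coproduct_def Let_def)
qed

text \<open>The morphism with the prescribed values on generators exists and solves the recursion;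
  uniqueness of solutions identifies it, on \<open>carrier W\<close>, with the function described by
  \<open>THE\<close>.\<close>

lemma LR_coproduct_hom:
  shows "dend_ops_hom K W S WW.T WW.TO (LR_coproduct K V)"
    and "v \<in> carrier V \<Longrightarrow> LR_coproduct K V (gen v) =
      WW.pt (gen v) \<one>\<^bsub>W\<^esub> \<oplus>\<^bsub>WW.T\<^esub> WW.pt \<one>\<^bsub>W\<^esub> (gen v)"
proof -
  let ?\<phi> = "\<lambda>v. WW.pt (gen v) \<one>\<^bsub>W\<^esub> \<oplus>\<^bsub>WW.T\<^esub> WW.pt \<one>\<^bsub>W\<^esub> (gen v)"
  have lin: "linear_map K V WW.T ?\<phi>"
    by (intro linear_map_add WW.T_module linear_map_comp[OF WW.pt_linear(1) gen_linear]
        linear_map_comp[OF WW.pt_linear(2) gen_linear] one_closed)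
  have zero: "counit WW.TO (?\<phi> v) = \<zero>\<^bsub>K\<^esub>" if "v \<in> carrier V" for v
    using that by (simp add: WW.ops_simps(4) WW.rc_add D.U_simps)
  obtain f where f: "dend_ops_hom K W S WW.T WW.TO f"
    and gen: "\<And>v. v \<in> carrier V \<Longrightarrow> f (gen v) = ?\<phi> v"
    by (rule dend_ops_hom_exists[OF field_K module_V WW.total_dendriform_tensor lin zero]) (assumption, rule that)
  have LR: "is_LR_coproduct K V f" by (rule hom_is_LR_coproduct[OF f gen])
  have vee_closed: "vee K V v x y \<in> carrier W"
    if "v \<in> carrier V" "x \<in> carrier W" "y \<in> carrier W" for v x y
    using that by (simp add: vee_eq del: unital_ops_simps)
  \<comment> \<open>The description asks for an extensional function, so the witness is
    \<open>f\<close> made undefined outside \<open>carrier W\<close>.\<close>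
  let ?f = "restrict f (carrier W)"
  have f_eq: "?f x = f x" if "x \<in> carrier W" for x
    using that by simp
  have "linear_map K W WW.T ?f"
    by (rule linear_mapI)
      (simp_all only: f_eq W.M.a_closed W.smult_closed linear_mapD[OF is_LR_coproductD(1)[OF LR]])
  then have LR_f: "is_LR_coproduct K V ?f"
    unfolding is_LR_coproduct_def Let_def
    by (intro conjI ballI)
      (simp_all only: f_eq one_closed vee_closed is_LR_coproductD(2,3)[OF LR])
  have "LR_coproduct K V = ?f"
    unfolding LR_coproduct_def
  proof (rule the_equality)
    show "?f \<in> extensional (carrier W) \<and> is_LR_coproduct K V ?f"
      by (intro conjI restrict_extensional LR_f)
    fix g assume g: "g \<in> extensional (carrier W) \<and> is_LR_coproduct K V g"
    show "g = ?f"
      by (rule extensionalityI[OF conjunct1[OF g] restrict_extensional])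
        (rule is_LR_coproduct_unique[OF conjunct2[OF g] LR_f])
  qed
  then have eq: "LR_coproduct K V x = f x" if "x \<in> carrier W" for x
    using f_eq[OF that] by (simp only:)
  show "LR_coproduct K V (gen v) = ?\<phi> v" if "v \<in> carrier V"
    by (simp only: eq[OF gen_closed[OF that]] gen[OF that])
  have "linear_map K W WW.T (LR_coproduct K V)"
    by (rule linear_mapI)
      (simp_all only: eq W.M.a_closed W.smult_closed linear_mapD[OF dend_ops_homD(1)[OF f]])
  then show "dend_ops_hom K W S WW.T WW.TO (LR_coproduct K V)"
    unfolding dend_ops_hom_def
    by (intro conjI ballI)
      (simp_all only: eq W.lprod_closed W.rprod_closed W.unit_in dend_ops_homD[OF f])
qed

end

section \<open>The dendriform bialgebra axioms\<close>

theorem proposition8: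
  fixes K :: "('k, 'm) ring_scheme" and V :: "('k, 'v, 'p) module_scheme"
  assumes "field K" and "module K V"
  shows "dendriform_bialgebra K (unitization K (free_dendriform K V)) (LR_coproduct K V)"
proof -
  interpret free_dend K V by (rule free_dend.intro) fact+
  let ?\<Delta> = "LR_coproduct K V"
  note hom = LR_coproduct_hom(1) and gen = LR_coproduct_hom(2)
  note W = W.total_dendriform_axioms and T = WW.total_dendriform_tensor
  \<comment> \<open>Each composite is an endomorphism of \<open>W\<close> that fixes the generators,
    because \<open>v \<otimes> 1 + 1 \<otimes> v\<close> goes to \<open>v\<close> under both counit
    maps.\<close>
  have rc: "WW.rc (?\<Delta> x) = x" and lc: "WW.lc (?\<Delta> x) = x" if x: "x \<in> carrier W" for x
    by (rule hom_ext[OF W dend_ops_hom_comp[OF hom WW.rc_hom] dend_ops_hom_id _ x],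
        simp add: gen WW.rc_add D.U_simps)
      (rule hom_ext[OF W dend_ops_hom_comp[OF hom WW.lc_hom] dend_ops_hom_id _ x],
        simp add: gen WW.lc_add D.U_simps)
  interpret R: total_dendriform_pair K W S WW.T WW.TO
    by (intro total_dendriform_pair.intro W T)
  interpret L: total_dendriform_pair K WW.T WW.TO W S
    by (intro total_dendriform_pair.intro W T)
  note l = tensor_map_hom[OF W W T W hom dend_ops_hom_id]
    and r = tensor_map_hom[OF W W W T dend_ops_hom_id hom]
    and a = tensor_assoc_hom[OF W W W]
  note lin = linear_mapD(2)[OF dend_ops_homD(1)[OF l(1)]] linear_mapD(2)[OF dend_ops_homD(1)[OF r(1)]]
    linear_mapD(2)[OF dend_ops_homD(1)[OF a(1)]]
  have one: "?\<Delta> \<one>\<^bsub>W\<^esub> = WW.pt \<one>\<^bsub>W\<^esub> \<one>\<^bsub>W\<^esub>"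
    using dend_ops_homD(4)[OF hom] by (simp add: WW.ops_simps(3))
  \<comment> \<open>Both sides are morphisms into \<open>W \<otimes> (W \<otimes> W)\<close>; on a
    generator both equal \<open>v \<otimes> 1 \<otimes> 1 + 1 \<otimes> v \<otimes> 1 + 1 \<otimes>
    1 \<otimes> v\<close>.\<close>
  have coassoc: "tensor_assoc K W W W (tensor_map K WW.T W ?\<Delta> (\<lambda>y. y) (?\<Delta> x)) =
      tensor_map K W WW.T (\<lambda>y. y) ?\<Delta> (?\<Delta> x)" if x: "x \<in> carrier W" for x
  proof (rule hom_ext[OF R.total_dendriform_tensor
        dend_ops_hom_comp[OF dend_ops_hom_comp[OF hom l(1)] a(1)] dend_ops_hom_comp[OF hom r(1)] _ x])
    fix v assume v: "v \<in> carrier V"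
    show "tensor_assoc K W W W (tensor_map K WW.T W ?\<Delta> (\<lambda>y. y) (?\<Delta> (gen v))) =
      tensor_map K W WW.T (\<lambda>y. y) ?\<Delta> (?\<Delta> (gen v))"
      using v by (simp add: gen lin l(2) r(2) a(2) one L.pt_add R.pt_add R.T.M.a_ac)
  qed
  have WU: "unital_dendriform_algebra K W" by (rule D.unital_dendriform_algebra_U)
  have aug: "x \<in> carrier W" if "x \<in> aug W" for x
    using that by (auto simp: D.U_simps)
  \<comment> \<open>The concrete products of the unitization already vanish at
    \<open>(1, 1)\<close>, hence agree with \<open>prec0\<close> and \<open>succ0\<close> on all of
    \<open>carrier W\<close>.\<close>
  have prec: "x \<prec>\<^bsub>W\<^esub> y = lprod S x y" "x \<succ>\<^bsub>W\<^esub> y = rprod S x y" if "x \<in> carrier W" "y \<in> carrier W" for x y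
    using that by (auto simp: D.U_simps)
  show ?thesis
  proof (intro dendriform_bialgebra.intro dendriform_bialgebra_axioms.intro WU coassoc one)
    show "linear_map K W WW.T ?\<Delta>" by (rule dend_ops_homD(1)[OF hom])
    fix x
    show "tensor_lift W (\<lambda>x1 x2. unit_coeff K W x1 \<odot>\<^bsub>W\<^esub> x2) (?\<Delta> x) = x" if "x \<in> carrier W"
      using lc[OF that] by (simp add: left_counit_def)
    show "tensor_lift W (\<lambda>x1 x2. unit_coeff K W x2 \<odot>\<^bsub>W\<^esub> x1) (?\<Delta> x) = x" if "x \<in> carrier W"
      using rc[OF that] by (simp add: right_counit_def)
    fix y
    assume "x \<in> aug W" "y \<in> aug W"
    then have xy: "x \<in> carrier W" "y \<in> carrier W" by (auto dest: aug)
    \<comment> \<open>The morphism property is the compatibility axiom once \<open>rc\<close> turns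
      the correction term of \<open>tensor_ops\<close> into
      \<open>(x \<succ> y) \<otimes> 1\<close>.\<close>
    show "?\<Delta> (x \<succ>\<^bsub>W\<^esub> y) = sweedler_prod K W (star K W) (succ0 K W) (?\<Delta> x) (?\<Delta> y)
        \<oplus>\<^bsub>WW.T\<^esub> WW.pt (x \<succ>\<^bsub>W\<^esub> y) \<one>\<^bsub>W\<^esub>"
      using dend_ops_homD(3)[OF hom xy]
      by (simp add: WW.ops_simps(2) rc xy prec sweedler_prod_eq full_prod_unital_ops)
    show "?\<Delta> (x \<prec>\<^bsub>W\<^esub> y) = sweedler_prod K W (star K W) (prec0 K W) (?\<Delta> x) (?\<Delta> y)
        \<oplus>\<^bsub>WW.T\<^esub> WW.pt (x \<prec>\<^bsub>W\<^esub> y) \<one>\<^bsub>W\<^esub>"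
      using dend_ops_homD(2)[OF hom xy]
      by (simp add: WW.ops_simps(1) rc xy prec sweedler_prod_eq full_prod_unital_ops)
  qed
qed

end
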